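(* Let $M$ be a loopless matroid of rank $d+1$ on $E=\{0,1,\dots,n\}$, and regard its Bergman class $\Delta_M\in\operatorname{MW}_d(\Sigma_{A_n})$ as an element of $A^{n-d}(\Sigma_{A_n})$ via the isomorphism $\delta_{\Sigma_{A_n}}:A^\bullet(\Sigma_{A_n})\to\operatorname{MW}_{n-\bullet}(\Sigma_{A_n})$. Then \[A^\bullet(M)\simeq A^\bullet(\Sigma_{A_n})/\operatorname{ann}(\Delta_M),\qquad \operatorname{ann}(\Delta_M)=\{\xi\in A^\bullet(\Sigma_{A_n}):\xi\cdot\Delta_M=0\}.\]
   Context: With $N=\mathbb Z^E/\mathbb Z\mathbf e_E$ and $u_S$ the image of $\sum_{i\in S}\mathbf e_i$, the braid fan $\Sigma_{A_n}$ has cones $\operatorname{Cone}(u_{S_1},\dots,u_{S_k})$ for chains $\emptyset\subsetneq S_1\subsetneq\cdots\subsetneq S_k\subsetneq E$. For a smooth fan $\Sigma$, $A^\bullet(\Sigma)=\mathbb R[x_\rho:\rho\in\Sigma(1)]/(\langle\text{monomials of non-faces}\rangle+\langle\sum_\rho m(u_\rho)x_\rho:m\in N^\vee\rangle)$. $\operatorname{MW}_\ell(\Sigma)$ is the space of balanced functions on $\ell$-cones; the cap product is $(\xi\cap\Delta)(\sigma)=$ value of $\prod_{\rho\in\tau}x_\rho\mapsto\Delta(\tau)$ on $\xi\prod_{\rho\in\sigma}x_\rho$; $\delta_{\Sigma_{A_n}}(\xi)=\xi\cap\Delta_{\Sigma_{A_n}}$ with $\Delta_{\Sigma_{A_n}}\equiv1$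 on $n$-cones is an isomorphism of graded groups. $\Delta_M$ is $1$ on $\operatorname{Cone}(u_{F_1},\dots,u_{F_d})$ with all $F_i$ flats of $M$ and $0$ otherwise. The Chow ring of $M$ is $A^\bullet(M)=A^\bullet(\Sigma_M)=\mathbb R[x_F: F\text{ nonempty proper flat}]/(\langle x_Fx_{F'}: F,F'\text{ incomparable}\rangle+\langle\sum_{F\ni i}x_F-\sum_{F\ni j}x_F: i,j\in E\rangle)$, where $\Sigma_M$ is the subfan of cones of chains of flats. *)

theory Defs
  imports Complex_Main "HOL-Library.Poly_Mapping" "HOL-Algebra.QuotRing"
begin

type_synonym poly = "(nat set \<Rightarrow>\<^sub>0 nat) \<Rightarrow>\<^sub>0 real"

definition Var :: "nat set \<Rightarrow> poly" where
  "Var S = Poly_Mapping.single (Poly_Mapping.single S 1) 1"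

definition Const :: "real \<Rightarrow> poly" where
  "Const c = Poly_Mapping.single 0 c"

definition polys_in :: "nat set set \<Rightarrow> poly set" where
  "polys_in V = {p. \<forall>m\<in>Poly_Mapping.keys p. Poly_Mapping.keys m \<subseteq> V}"

definition homog :: "nat \<Rightarrow> poly set" where
  "homog k = {p. \<forall>m\<in>Poly_Mapping.keys p. (\<Sum>v\<in>Poly_Mapping.keys m. Poly_Mapping.lookup m v) = k}"

definition poly_ring :: "nat set set \<Rightarrow> poly ring" where
  "poly_ring V = \<lparr>carrier = polys_in V, mult = (*), one = 1, zero = 0, add = (+)\<rparr>"

definition graded_piece :: "nat set set \<Rightarrow> poly set \<Rightarrow> nat \<Rightarrow> poly set set" where
  "graded_piece V I k = {I +>\<^bsub>poly_ring V\<^esub> p | p. p \<in> polys_in V \<inter> homog k}"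

definition annihilator :: "('a, 'm) ring_scheme \<Rightarrow> 'a \<Rightarrow> 'a set" where
  "annihilator R D = {\<xi> \<in> carrier R. \<xi> \<otimes>\<^bsub>R\<^esub> D = \<zero>\<^bsub>R\<^esub>}"

definition rays :: "nat \<Rightarrow> nat set set" where
  "rays n = {S. S \<noteq> {} \<and> S \<subset> {0..n}}"

definition is_chain :: "nat set set \<Rightarrow> bool" where
  "is_chain C = (\<forall>S\<in>C. \<forall>T\<in>C. S \<subseteq> T \<or> T \<subseteq> S)"

text \<open>the l-dimensional cones of Sigma_{A_n}, identified with their sets of rays (chains)\<close>
definition braid_cone :: "nat \<Rightarrow> nat \<Rightarrow> nat set set \<Rightarrow> bool" where
  "braid_cone n l C = (C \<subseteq> rays n \<and> is_chain C \<and> card C = l)"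

definition mono :: "nat set set \<Rightarrow> poly" where
  "mono C = (\<Prod>S\<in>C. Var S)"

text \<open>generators: monomials of non-faces, and linear forms sum_rho m(u_rho) x_rho for m in N^dual,
  where N = Z^E / Z e_E, so N^dual = {m : sum_{i in E} m_i = 0} and m(u_S) = sum_{i in S} m_i\<close>
definition braid_ideal_gens :: "nat \<Rightarrow> poly set" where
  "braid_ideal_gens n =
     {mono T | T. T \<subseteq> rays n \<and> \<not> is_chain T}
   \<union> {(\<Sum>S\<in>rays n. Const (real_of_int (\<Sum>i\<in>S. m i)) * Var S) | m :: nat \<Rightarrow> int.
        (\<forall>i. i \<notin> {0..n} \<longrightarrow> m i = 0) \<and> (\<Sum>i\<in>{0..n}. m i) = 0}"

definition braid_ideal :: "nat \<Rightarrow> poly set" where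
  "braid_ideal n = genideal (poly_ring (rays n)) (braid_ideal_gens n)"

definition chow_braid :: "nat \<Rightarrow> poly set ring" where
  "chow_braid n = poly_ring (rays n) Quot braid_ideal n"

text \<open>value on q in A^l(Sigma) of the linear functional prod_{rho in tau} x_rho |-> Delta(tau)\<close>
definition mw_eval :: "nat \<Rightarrow> nat \<Rightarrow> (nat set set \<Rightarrow> real) \<Rightarrow> poly set \<Rightarrow> real" where
  "mw_eval n l \<Delta> q = (THE c. \<exists>a :: nat set set \<Rightarrow> real.
      q = braid_ideal n +>\<^bsub>poly_ring (rays n)\<^esub>
            (\<Sum>\<tau>\<in>{\<tau>. braid_cone n l \<tau>}. Const (a \<tau>) * mono \<tau>)
    \<and> c = (\<Sum>\<tau>\<in>{\<tau>. braid_cone n l \<tau>}. a \<tau> * \<Delta> \<tau>))"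

definition cap :: "nat \<Rightarrow> nat \<Rightarrow> poly set \<Rightarrow> (nat set set \<Rightarrow> real) \<Rightarrow> nat set set \<Rightarrow> real" where
  "cap n l \<xi> \<Delta> \<sigma> =
     mw_eval n l \<Delta> (\<xi> \<otimes>\<^bsub>chow_braid n\<^esub> (braid_ideal n +>\<^bsub>poly_ring (rays n)\<^esub> mono \<sigma>))"

text \<open>delta_{Sigma_{A_n}}(xi) = xi cap Delta_{Sigma_{A_n}}, with Delta_{Sigma_{A_n}} = 1 on n-cones\<close>
definition delta_braid :: "nat \<Rightarrow> poly set \<Rightarrow> nat set set \<Rightarrow> real" where
  "delta_braid n \<xi> = cap n n \<xi> (\<lambda>_. 1)"

definition matroid_rank :: "nat set \<Rightarrow> (nat set \<Rightarrow> nat) \<Rightarrow> bool" where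
  "matroid_rank E r =
     ((\<forall>X. X \<subseteq> E \<longrightarrow> r X \<le> card X)
    \<and> (\<forall>X Y. X \<subseteq> Y \<and> Y \<subseteq> E \<longrightarrow> r X \<le> r Y)
    \<and> (\<forall>X Y. X \<subseteq> E \<and> Y \<subseteq> E \<longrightarrow> r (X \<union> Y) + r (X \<inter> Y) \<le> r X + r Y))"

definition loopless :: "nat set \<Rightarrow> (nat set \<Rightarrow> nat) \<Rightarrow> bool" where
  "loopless E r = (\<forall>i\<in>E. r {i} \<noteq> 0)"

definition is_flat :: "nat set \<Rightarrow> (nat set \<Rightarrow> nat) \<Rightarrow> nat set \<Rightarrow> bool" where
  "is_flat E r F = (F \<subseteq> E \<and> (\<forall>x\<in>E - F. r F < r (insert x F)))"

definition proper_flats :: "nat set \<Rightarrow> (nat set \<Rightarrow> nat) \<Rightarrow> nat set set" where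
  "proper_flats E r = {F. is_flat E r F \<and> F \<noteq> {} \<and> F \<noteq> E}"

definition chow_matroid_gens :: "nat set \<Rightarrow> (nat set \<Rightarrow> nat) \<Rightarrow> poly set" where
  "chow_matroid_gens E r =
     {Var F * Var G | F G. F \<in> proper_flats E r \<and> G \<in> proper_flats E r \<and> \<not> F \<subseteq> G \<and> \<not> G \<subseteq> F}
   \<union> {(\<Sum>F\<in>{F \<in> proper_flats E r. i \<in> F}. Var F) - (\<Sum>F\<in>{F \<in> proper_flats E r. j \<in> F}. Var F)
        | i j. i \<in> E \<and> j \<in> E}"

definition chow_matroid_ideal :: "nat set \<Rightarrow> (nat set \<Rightarrow> nat) \<Rightarrow> poly set" where
  "chow_matroid_ideal E r = genideal (poly_ring (proper_flats E r)) (chow_matroid_gens E r)"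

definition chow_matroid :: "nat set \<Rightarrow> (nat set \<Rightarrow> nat) \<Rightarrow> poly set ring" where
  "chow_matroid E r = poly_ring (proper_flats E r) Quot chow_matroid_ideal E r"

definition bergman_class :: "nat set \<Rightarrow> (nat set \<Rightarrow> nat) \<Rightarrow> nat set set \<Rightarrow> real" where
  "bergman_class E r \<sigma> = (if \<forall>F\<in>\<sigma>. is_flat E r F then 1 else 0)"

end

theory Submission
  imports Defs "HOL-Library.Multiset"
begin

text \<open>
  Killing the variables of non-flats maps \<open>A(\<Sigma>)\<close> of the braid fan onto \<open>A(M)\<close>, and
  \<open>deg(\<xi> \<cdot> \<Delta>) = deg_M(\<xi>)\<close> because both sides agree on the squarefree chain monomials, to which
  every functional on \<open>A(\<Sigma>)\<close> can be reduced. Hence the theorem follows from Poincare duality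
  for Chow rings of loopless matroids: the Boolean matroid gives the braid fan.

  For Poincare duality we use the generators \<open>h_F = - \<Sum> x_G\<close>, summed over the nonempty flats
  \<open>G \<supseteq> F\<close> where \<open>x_E = - \<alpha>\<close>. The degree of a monomial in
  the \<open>h_F\<close> is 0 or 1 according to the dragon Hall-Rado condition, and this defines the degree
  map. The products of \<open>h_F\<close> over chains with exponents bounded by rank differences span the
  Chow ring. For a chain \<open>F_1 \<subset> \<dots> \<subset> F_k\<close> of proper flats with ranks \<open>r_i\<close> and exponents \<open>a_i\<close>
  the element \<open>\<Prod> x_{F_i} h_{F_i}^(r_i - r_(i-1) - 1 - a_i)\<close>, times a power of \<open>h_E\<close>, pairs to 1
  with the corresponding product, and it pairs to 0 with every other spanning product whose sum of
  ranks is not smaller. So the pairing is triangular and therefore nondegenerate.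
\<close>

section \<open>Polynomials\<close>

text \<open>Duality is used twice. By duality for the Boolean matroid, \<xi> kills \<Delta> iff
  \<open>deg(\<xi> \<cdot> \<eta> \<cdot> \<Delta>) = 0\<close> for all \<eta>. This degree is
  \<open>deg_M(\<xi> \<cdot> \<eta>)\<close>, and by duality for M it vanishes for all \<eta> iff
  \<xi> becomes 0 in A(M). The obstacle in duality itself is that a ring given by generators and
  relations shows no nonzero functional. The degree is therefore prescribed on a free polynomial
  ring with one variable for each h_F, where no relation has to be respected, and the polynomials
  all of whose multiples have degree 0 form an ideal there. Only the two kinds of Chow generators,
  rewritten in the h_F, have to be placed in that ideal; for the quadratic ones this comes down to
  uncrossing two violating sets of the dragon condition. Conversely, let p pair to 0 with everything
  and expand it in the spanning products: among the terms with nonzero coefficient, one of least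
  rank sum is isolated by its test element, a contradiction.\<close>

abbreviation lkp :: "('a \<Rightarrow>\<^sub>0 'b::zero) \<Rightarrow> 'a \<Rightarrow> 'b" where
  "lkp \<equiv> Poly_Mapping.lookup"

abbreviation sgl :: "'a \<Rightarrow> 'b \<Rightarrow> 'a \<Rightarrow>\<^sub>0 'b::zero" where
  "sgl \<equiv> Poly_Mapping.single"

lemma Const_0 [simp]: "Const 0 = 0"
  by (simp add: Const_def)

lemma Const_1 [simp]: "Const 1 = 1"
  by (simp add: Const_def)

lemma Const_add: "Const (a + b) = Const a + Const b"
  by (simp add: Const_def single_add)

lemma Const_mult: "Const (a * b) = Const a * Const b"
  by (simp add: Const_def mult_single)

lemma Const_uminus: "Const (- a) = - Const a"
  by (simp add: Const_def single_uminus)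

lemma single_eq_Const_mult: "sgl m c = Const c * sgl m 1"
  by (simp add: Const_def mult_single)

lemma poly_mapping_add_induct [case_names single add]:
  fixes p :: "'a \<Rightarrow>\<^sub>0 'b::comm_monoid_add"
  assumes "\<And>m c. P (sgl m c)" and "\<And>p q. P p \<Longrightarrow> P q \<Longrightarrow> P (p + q)"
  shows "P p"
proof (induction p rule: update_induct)
  case const
  show ?case using assms(1)[of undefined 0] by simp
next
  case (update f a b)
  have "Poly_Mapping.update a b f = f + sgl a b"
    using update
    by (intro poly_mapping_eqI)
       (auto simp: lookup_update lookup_add lookup_single when_def in_keys_iff)
  then show ?case using update assms by simp
qed

text \<open>The product steps take one variable at a time. Closure of a linear span under
  multiplication by variables, as needed for \<open>spanned_all\<close>, fits this form
  directly.\<close>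

lemma poly_induct [case_names one Var Const add]:
  fixes p :: poly
  assumes one: "P 1" and Var: "\<And>p S. P p \<Longrightarrow> P (Var S * p)"
    and Const: "\<And>p c. P p \<Longrightarrow> P (Const c * p)"
    and add: "\<And>p q. P p \<Longrightarrow> P q \<Longrightarrow> P (p + q)"
  shows "P p"
proof (induction p rule: poly_mapping_add_induct)
  case (single m c)
  have "P (sgl m 1)"
  proof (induction m rule: poly_mapping_add_induct)
    case (single S k)
    have "P (sgl (sgl S k) 1)"
    proof (induction k)
      case (Suc k)
      have "sgl (sgl S (Suc k)) 1 = Var S * sgl (sgl S k) 1"
        by (simp add: Var_def mult_single single_add[symmetric])
      then show ?case using Var Suc by simp
    qed (simp add: one)
    then show ?case .
  next
    case (add m m')
    \<comment> \<open>The induction hypotheses concern the two factors separately and say nothing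
      about their product, so the second factor is multiplied in variable by variable.\<close>
    have "P (sgl (m + m'') 1)" if "P (sgl m 1)" for m m''
      using that
    proof (induction m'' arbitrary: m rule: poly_mapping_add_induct)
      case (single S k)
      then show ?case
      proof (induction k)
        case (Suc k)
        have "sgl (m + sgl S (Suc k)) 1 = Var S * sgl (m + sgl S k) 1"
          by (simp add: Var_def mult_single single_add[symmetric] add.left_commute)
        then show ?case using Var Suc by simp
      qed simp
    next
      case (add p q)
      then show ?case by (simp add: add.assoc[symmetric])
    qed
    then show ?case using add by simp
  qed
  then have "P (Const c * sgl m 1)" by (rule Const)
  then show ?case by (simp add: single_eq_Const_mult[of m c])
next
  case (add p q)
  then show ?case by (rule assms(4))
qed

section \<open>Linear functionals and substitution homomorphisms\<close>

definition lin_ext :: "((nat set \<Rightarrow>\<^sub>0 nat) \<Rightarrow> real) \<Rightarrow> poly \<Rightarrow> real" where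
  "lin_ext w p = (\<Sum>m\<in>Poly_Mapping.keys p. lkp p m * w m)"

lemma lin_ext_superset:
  assumes "finite A" "Poly_Mapping.keys p \<subseteq> A"
  shows "lin_ext w p = (\<Sum>m\<in>A. lkp p m * w m)"
  unfolding lin_ext_def using assms
  by (intro sum.mono_neutral_left) (auto simp: in_keys_iff)

lemma lin_ext_add: "lin_ext w (p + q) = lin_ext w p + lin_ext w q"
proof -
  let ?A = "Poly_Mapping.keys p \<union> Poly_Mapping.keys q"
  have "Poly_Mapping.keys (p + q) \<subseteq> ?A" by (rule keys_add)
  then show ?thesis
    by (simp add: lin_ext_superset[of ?A] lookup_add ring_distribs sum.distrib)
qed

lemma lin_ext_single: "lin_ext w (sgl m c) = c * w m"
  by (simp add: lin_ext_superset[of "{m}"])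

lemma lin_ext_Const: "lin_ext w (Const c * p) = c * lin_ext w p"
proof (induction p rule: poly_mapping_add_induct)
  case (single m c')
  then show ?case by (simp add: Const_def mult_single lin_ext_single)
qed (simp add: lin_ext_add ring_distribs)

definition monom_eval :: "(nat set \<Rightarrow> poly) \<Rightarrow> (nat set \<Rightarrow>\<^sub>0 nat) \<Rightarrow> poly" where
  "monom_eval f m = (\<Prod>v\<in>Poly_Mapping.keys m. f v ^ lkp m v)"

definition subst :: "(nat set \<Rightarrow> poly) \<Rightarrow> poly \<Rightarrow> poly" where
  "subst f p = (\<Sum>m\<in>Poly_Mapping.keys p. Const (lkp p m) * monom_eval f m)"

lemma monom_eval_superset:
  assumes "finite A" "Poly_Mapping.keys m \<subseteq> A"
  shows "monom_eval f m = (\<Prod>v\<in>A. f v ^ lkp m v)"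
  unfolding monom_eval_def using assms
  by (intro prod.mono_neutral_left) (auto simp: in_keys_iff)

lemma monom_eval_add: "monom_eval f (m + m') = monom_eval f m * monom_eval f m'"
proof -
  let ?A = "Poly_Mapping.keys m \<union> Poly_Mapping.keys m'"
  have "Poly_Mapping.keys (m + m') \<subseteq> ?A" by (rule keys_add)
  then show ?thesis
    by (simp add: monom_eval_superset[of ?A] lookup_add power_add prod.distrib)
qed

lemma subst_superset:
  assumes "finite A" "Poly_Mapping.keys p \<subseteq> A"
  shows "subst f p = (\<Sum>m\<in>A. Const (lkp p m) * monom_eval f m)"
  unfolding subst_def using assms
  by (intro sum.mono_neutral_left) (auto simp: in_keys_iff)

lemma subst_add: "subst f (p + q) = subst f p + subst f q"
proof -
  let ?A = "Poly_Mapping.keys p \<union> Poly_Mapping.keys q"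
  have "Poly_Mapping.keys (p + q) \<subseteq> ?A" by (rule keys_add)
  then show ?thesis
    by (simp add: subst_superset[of ?A] lookup_add Const_add ring_distribs sum.distrib)
qed

lemma subst_single: "subst f (sgl m c) = Const c * monom_eval f m"
  by (simp add: subst_superset[of "{m}"])

lemma subst_0 [simp]: "subst f 0 = 0"
  by (simp add: subst_def)

lemma subst_1 [simp]: "subst f 1 = 1"
  using subst_single[of f 0 1] by (simp add: monom_eval_def)

lemma subst_mult: "subst f (p * q) = subst f p * subst f q"
proof (induction p rule: poly_mapping_add_induct)
  case (single m c)
  show ?case
  proof (induction q rule: poly_mapping_add_induct)
    case (single m' c')
    then show ?case
      by (simp add: mult_single subst_single monom_eval_add Const_mult)
  qed (simp add: subst_add ring_distribs)
qed (simp add: subst_add ring_distribs)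

lemma subst_Const [simp]: "subst f (Const c) = Const c"
  unfolding Const_def by (subst subst_single) (simp add: Const_def monom_eval_def)

lemma subst_Var [simp]: "subst f (Var S) = f S"
  unfolding Var_def
  by (subst subst_single) (simp add: monom_eval_superset[of "{S}"])

lemma subst_uminus: "subst f (- p) = - subst f p"
  using subst_add[of f p "- p"] by (simp add: eq_neg_iff_add_eq_0 add.commute)

lemma subst_diff: "subst f (p - q) = subst f p - subst f q"
  using subst_add[of f p "- q"] by (simp add: subst_uminus)

lemma subst_sum: "subst f (sum g A) = (\<Sum>a\<in>A. subst f (g a))"
  by (induction A rule: infinite_finite_induct) (auto simp: subst_add)

lemma subst_prod: "subst f (prod g A) = (\<Prod>a\<in>A. subst f (g a))"
  by (induction A rule: infinite_finite_induct) (auto simp: subst_mult)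

lemma subst_power: "subst f (p ^ k) = subst f p ^ k"
  by (induction k) (auto simp: subst_mult)

lemmas subst_simps = subst_add subst_mult subst_uminus subst_diff subst_sum subst_prod subst_power

lemma subst_subst: "subst f (subst g p) = subst (\<lambda>S. subst f (g S)) p"
  by (induction p rule: poly_induct) (auto simp: subst_simps)

section \<open>Total degree and homogeneous polynomials\<close>

definition tdeg :: "(nat set \<Rightarrow>\<^sub>0 nat) \<Rightarrow> nat" where
  "tdeg m = (\<Sum>v\<in>Poly_Mapping.keys m. lkp m v)"

lemma tdeg_superset:
  assumes "finite A" "Poly_Mapping.keys m \<subseteq> A"
  shows "tdeg m = (\<Sum>v\<in>A. lkp m v)"
  unfolding tdeg_def using assms
  by (intro sum.mono_neutral_left) (auto simp: in_keys_iff)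

lemma tdeg_add: "tdeg (m + m') = tdeg m + tdeg m'"
proof -
  let ?A = "Poly_Mapping.keys m \<union> Poly_Mapping.keys m'"
  have "Poly_Mapping.keys (m + m') \<subseteq> ?A" by (rule keys_add)
  then show ?thesis
    by (simp add: tdeg_superset[of ?A] lookup_add sum.distrib)
qed

lemma tdeg_single [simp]: "tdeg (sgl S k) = k"
  by (simp add: tdeg_superset[of "{S}"])

lemma tdeg_0 [simp]: "tdeg 0 = 0"
  by (simp add: tdeg_def)

lemma tdeg_eq_0_iff: "tdeg m = 0 \<longleftrightarrow> m = 0"
  by (auto simp: tdeg_def in_keys_iff intro!: poly_mapping_eqI)

lemma homog_iff: "p \<in> homog k \<longleftrightarrow> (\<forall>m\<in>Poly_Mapping.keys p. tdeg m = k)"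
  by (auto simp: homog_def tdeg_def)

lemma homog_0 [simp]: "0 \<in> homog k"
  by (simp add: homog_iff)

lemma homog_single: "tdeg m = k \<Longrightarrow> sgl m c \<in> homog k"
  by (auto simp: homog_iff split: if_splits)

lemma homog_Const [simp]: "Const c \<in> homog 0"
  by (simp add: Const_def homog_single)

lemma homog_1 [simp]: "1 \<in> homog 0"
  using homog_Const[of 1] by simp

lemma homog_Var [simp]: "Var S \<in> homog (Suc 0)"
  by (simp add: Var_def homog_single)

lemma homog_add: "p \<in> homog k \<Longrightarrow> q \<in> homog k \<Longrightarrow> p + q \<in> homog k"
  using keys_add[of p q] by (auto simp: homog_iff)

lemma homog_uminus: "p \<in> homog k \<Longrightarrow> - p \<in> homog k"
  by (auto simp: homog_iff)

lemma homog_diff: "p \<in> homog k \<Longrightarrow> q \<in> homog k \<Longrightarrow> p - q \<in> homog k"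
  using homog_add[of p k "- q"] by (simp add: homog_uminus)

lemma homog_sum: "(\<And>a. a \<in> A \<Longrightarrow> g a \<in> homog k) \<Longrightarrow> sum g A \<in> homog k"
  by (induction A rule: infinite_finite_induct) (auto simp: homog_add)

lemma homog_mult: "p \<in> homog j \<Longrightarrow> q \<in> homog k \<Longrightarrow> p * q \<in> homog (j + k)"
  using keys_mult[of p q] by (fastforce simp: homog_iff tdeg_add)

lemma homog_Const_mult: "p \<in> homog k \<Longrightarrow> Const c * p \<in> homog k"
  using homog_mult[of "Const c" 0 p k] by simp

lemma homog_power: "p \<in> homog 1 \<Longrightarrow> p ^ k \<in> homog k"
  by (induction k) (use homog_mult[of p 1] in auto)

lemma homog_prod:
  "finite A \<Longrightarrow> (\<And>a. a \<in> A \<Longrightarrow> g a \<in> homog (w a)) \<Longrightarrow> prod g A \<in> homog (sum w A)"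
  by (induction A rule: finite_induct) (auto simp: homog_mult)

lemma homog_mono: "finite C \<Longrightarrow> mono C \<in> homog (card C)"
  using homog_prod[of C Var "\<lambda>_. 1"] by (simp add: mono_def)

lemma homog_subst:
  assumes "\<And>S. f S \<in> homog 1" and "p \<in> homog k"
  shows "subst f p \<in> homog k"
  unfolding subst_def
proof (intro homog_sum homog_Const_mult)
  fix m assume "m \<in> Poly_Mapping.keys p"
  then have "tdeg m = k" using assms(2) by (auto simp: homog_iff)
  moreover have "monom_eval f m \<in> homog (tdeg m)"
    unfolding monom_eval_def tdeg_def by (intro homog_prod homog_power assms) auto
  ultimately show "monom_eval f m \<in> homog k" by simp
qed

section \<open>Polynomials in a given set of variables\<close>

lemma polys_in_Const [simp]: "Const c \<in> polys_in V"
  by (auto simp: polys_in_def Const_def)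

lemma polys_in_0 [simp]: "0 \<in> polys_in V" and polys_in_1 [simp]: "1 \<in> polys_in V"
  by (auto simp: polys_in_def)

lemma polys_in_Var [simp]: "Var S \<in> polys_in V \<longleftrightarrow> S \<in> V"
  by (auto simp: polys_in_def Var_def)

lemma polys_in_add: "p \<in> polys_in V \<Longrightarrow> q \<in> polys_in V \<Longrightarrow> p + q \<in> polys_in V"
  using keys_add[of p q] by (auto simp: polys_in_def)

lemma polys_in_uminus: "p \<in> polys_in V \<Longrightarrow> - p \<in> polys_in V"
  by (auto simp: polys_in_def)

lemma polys_in_diff: "p \<in> polys_in V \<Longrightarrow> q \<in> polys_in V \<Longrightarrow> p - q \<in> polys_in V"
  using polys_in_add[of p V "- q"] by (simp add: polys_in_uminus)

lemma polys_in_mult: "p \<in> polys_in V \<Longrightarrow> q \<in> polys_in V \<Longrightarrow> p * q \<in> polys_in V"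
proof -
  assume *: "p \<in> polys_in V" "q \<in> polys_in V"
  have "Poly_Mapping.keys (a + b) \<subseteq> V"
    if "a \<in> Poly_Mapping.keys p" "b \<in> Poly_Mapping.keys q" for a b
    using keys_add[of a b] * that by (auto simp: polys_in_def)
  then show ?thesis
    using keys_mult[of p q] unfolding polys_in_def by blast
qed

lemma polys_in_sum: "(\<And>a. a \<in> A \<Longrightarrow> g a \<in> polys_in V) \<Longrightarrow> sum g A \<in> polys_in V"
  by (induction A rule: infinite_finite_induct) (auto simp: polys_in_add)

lemma polys_in_prod: "(\<And>a. a \<in> A \<Longrightarrow> g a \<in> polys_in V) \<Longrightarrow> prod g A \<in> polys_in V"
  by (induction A rule: infinite_finite_induct) (auto simp: polys_in_mult)

lemma polys_in_mono: "C \<subseteq> V \<Longrightarrow> mono C \<in> polys_in V"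
  unfolding mono_def by (intro polys_in_prod) auto

lemma polys_in_subset: "V \<subseteq> W \<Longrightarrow> polys_in V \<subseteq> polys_in W"
  by (auto simp: polys_in_def)

lemma subst_in_polys_in:
  assumes "\<And>S. f S \<in> polys_in V"
  shows "subst f p \<in> polys_in V"
  by (induction p rule: poly_induct) (auto simp: subst_simps intro: polys_in_mult polys_in_add assms)

lemma subst_id_on:
  assumes "p \<in> polys_in V" and "\<And>S. S \<in> V \<Longrightarrow> f S = Var S"
  shows "subst f p = p"
proof -
  have id: "subst Var q = q" for q
    by (induction q rule: poly_induct) (auto simp: subst_simps)
  have "subst f p = subst Var p"
    unfolding subst_def monom_eval_def
    using assms by (intro sum.cong prod.cong arg_cong2[where f = "(*)"] refl) (metis (mono_tags, lifting) mem_Collect_eq polys_in_def subsetD)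
  then show ?thesis by (simp add: id)
qed

lemma cring_poly_ring: "cring (poly_ring V)"
proof (rule cringI)
  show "abelian_group (poly_ring V)"
  proof (rule abelian_groupI)
    fix p assume "p \<in> carrier (poly_ring V)"
    then show "\<exists>q\<in>carrier (poly_ring V). q \<oplus>\<^bsub>poly_ring V\<^esub> p = \<zero>\<^bsub>poly_ring V\<^esub>"
      by (intro bexI[of _ "- p"]) (auto simp: poly_ring_def polys_in_uminus)
  qed (auto simp: poly_ring_def polys_in_add)
  show "comm_monoid (poly_ring V)"
    by (intro comm_monoidI) (auto simp: poly_ring_def polys_in_mult)
qed (auto simp: poly_ring_def ring_distribs)

section \<open>The Chow ideal of a loopless matroid\<close>

lemma ideal_genideal: "G \<subseteq> polys_in V \<Longrightarrow> ideal (genideal (poly_ring V) G) (poly_ring V)"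
  using ring.genideal_ideal[OF cring.axioms(1)[OF cring_poly_ring]] by (simp add: poly_ring_def)

lemma genideal_props:
  assumes "G \<subseteq> polys_in V"
  defines "I \<equiv> genideal (poly_ring V) G"
  shows "G \<subseteq> I" "I \<subseteq> polys_in V" "0 \<in> I"
    and "\<And>p q. p \<in> I \<Longrightarrow> q \<in> I \<Longrightarrow> p + q \<in> I"
    and "\<And>p q. p \<in> I \<Longrightarrow> q \<in> polys_in V \<Longrightarrow> q * p \<in> I"
proof -
  interpret ideal I "poly_ring V" unfolding I_def by (rule ideal_genideal[OF assms(1)])
  show "G \<subseteq> I" unfolding I_def genideal_def by blast
  show "I \<subseteq> polys_in V" using a_subset by (simp add: poly_ring_def)
  show "0 \<in> I" using additive_subgroup.zero_closed[OF is_additive_subgroup] by (simp add: poly_ring_def)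
  show "p + q \<in> I" if "p \<in> I" "q \<in> I" for p q
    using additive_subgroup.a_closed[OF is_additive_subgroup that] by (simp add: poly_ring_def)
  show "q * p \<in> I" if "p \<in> I" "q \<in> polys_in V" for p q
    using I_l_closed[of p q] that by (simp add: poly_ring_def)
qed

lemma idealI_polys:
  assumes "J \<subseteq> polys_in V" "0 \<in> J"
    and "\<And>p q. p \<in> J \<Longrightarrow> q \<in> J \<Longrightarrow> p + q \<in> J"
    and "\<And>p q. p \<in> J \<Longrightarrow> q \<in> polys_in V \<Longrightarrow> q * p \<in> J"
  shows "ideal J (poly_ring V)"
proof (rule idealI)
  interpret cring "poly_ring V" by (rule cring_poly_ring)
  show "ring (poly_ring V)" by (rule local.ring_axioms)
  show "subgroup J (add_monoid (poly_ring V))"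
  proof (rule subgroup.intro)
    show "inv\<^bsub>add_monoid (poly_ring V)\<^esub> x \<in> J" if "x \<in> J" for x
    proof -
      have "- x \<in> J" using assms(4)[OF that, of "- 1"] by (simp add: polys_in_uminus)
      moreover have "inv\<^bsub>add_monoid (poly_ring V)\<^esub> x = - x"
        using that assms(1) add.inv_equality[of "- x" x]
        by (auto simp: poly_ring_def polys_in_uminus a_inv_def)
      ultimately show ?thesis by simp
    qed
  qed (use assms in \<open>auto simp: poly_ring_def\<close>)
  show "x \<otimes>\<^bsub>poly_ring V\<^esub> a \<in> J" if "a \<in> J" "x \<in> carrier (poly_ring V)" for a x
    using assms(4)[of a x] that by (simp add: poly_ring_def)
  show "a \<otimes>\<^bsub>poly_ring V\<^esub> x \<in> J" if "a \<in> J" "x \<in> carrier (poly_ring V)" for a x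
    using assms(4)[of a x] that by (simp add: poly_ring_def mult.commute)
qed

lemma genideal_polys_minimal:
  assumes "G \<subseteq> J" "J \<subseteq> polys_in V" "0 \<in> J"
    and "\<And>p q. p \<in> J \<Longrightarrow> q \<in> J \<Longrightarrow> p + q \<in> J"
    and "\<And>p q. p \<in> J \<Longrightarrow> q \<in> polys_in V \<Longrightarrow> q * p \<in> J"
  shows "genideal (poly_ring V) G \<subseteq> J"
  using idealI_polys[OF assms(2-5)] assms(1) unfolding genideal_def by blast

section \<open>Rank, flats and closure\<close>

locale loopless_matroid =
  fixes n d :: nat and r :: "nat set \<Rightarrow> nat"
  assumes matroid: "matroid_rank {0..n} r"
    and loopless: "loopless {0..n} r"
    and rank_E: "r {0..n} = d + 1"
begin

abbreviation E :: "nat set" where "E \<equiv> {0..n}"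

abbreviation flat :: "nat set \<Rightarrow> bool" where "flat \<equiv> is_flat E r"

abbreviation PF :: "nat set set" where "PF \<equiv> proper_flats E r"

definition NF :: "nat set set" where "NF = insert E PF"

lemma rank_mono: "X \<subseteq> Y \<Longrightarrow> Y \<subseteq> E \<Longrightarrow> r X \<le> r Y"
  using matroid unfolding matroid_rank_def by blast

lemma rank_submod: "X \<subseteq> E \<Longrightarrow> Y \<subseteq> E \<Longrightarrow> r (X \<union> Y) + r (X \<inter> Y) \<le> r X + r Y"
  using matroid unfolding matroid_rank_def by blast

lemma rank_empty [simp]: "r {} = 0"
  using matroid unfolding matroid_rank_def by (metis card.empty empty_subsetI le_zero_eq)

lemma rank_pos: "X \<subseteq> E \<Longrightarrow> X \<noteq> {} \<Longrightarrow> 0 < r X"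
proof -
  assume "X \<subseteq> E" "X \<noteq> {}"
  then obtain i where "i \<in> X" by blast
  then have "0 < r {i}" using loopless \<open>X \<subseteq> E\<close> unfolding loopless_def by auto
  also have "r {i} \<le> r X" using \<open>i \<in> X\<close> \<open>X \<subseteq> E\<close> by (intro rank_mono) auto
  finally show ?thesis .
qed

lemma flat_subset: "flat F \<Longrightarrow> F \<subseteq> E"
  by (simp add: is_flat_def)

lemma flat_E: "flat E"
  by (simp add: is_flat_def)

lemma flat_empty: "flat {}"
  using rank_pos by (auto simp: is_flat_def)

lemma PF_iff: "F \<in> PF \<longleftrightarrow> flat F \<and> F \<noteq> {} \<and> F \<noteq> E"
  by (auto simp: proper_flats_def)

lemma NF_iff: "F \<in> NF \<longleftrightarrow> flat F \<and> F \<noteq> {}"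
  using flat_E by (auto simp: NF_def PF_iff)

lemma PF_subset_NF: "F \<in> PF \<Longrightarrow> F \<in> NF"
  by (simp add: NF_def)

lemma E_NF: "E \<in> NF"
  by (simp add: NF_def)

lemma finite_flats: "finite {F. flat F}"
  by (rule finite_subset[of _ "Pow E"]) (auto simp: is_flat_def)

lemma finite_PF [simp]: "finite PF"
  by (rule finite_subset[OF _ finite_flats]) (auto simp: PF_iff)

lemma finite_NF [simp]: "finite NF"
  by (simp add: NF_def)

lemma PF_subset_E: "F \<in> PF \<Longrightarrow> F \<subseteq> E" and NF_subset_E: "F \<in> NF \<Longrightarrow> F \<subseteq> E"
  using flat_subset by (auto simp: PF_iff NF_iff)

lemma flat_rank_less: "flat F \<Longrightarrow> X \<subseteq> E \<Longrightarrow> F \<subset> X \<Longrightarrow> r F < r X"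
proof -
  assume F: "flat F" and X: "X \<subseteq> E" "F \<subset> X"
  then obtain x where "x \<in> X" "x \<notin> F" by blast
  then have "r F < r (insert x F)" using F X by (auto simp: is_flat_def)
  also have "\<dots> \<le> r X" using X \<open>x \<in> X\<close> by (intro rank_mono) auto
  finally show ?thesis .
qed

lemma flat_rank_le: "flat F \<Longrightarrow> r F \<le> d + 1"
  using rank_mono[of F E] rank_E by (simp add: is_flat_def)

text \<open>A maximal set Y above X of the same rank works. If a flat G above X did not contain Y,
  then \<open>G \<union> Y\<close> would have larger rank than G, whereas submodularity bounds the
  increase by \<open>r Y - r (G \<inter> Y) \<le> 0\<close>.\<close>

lemma closure_exists:
  assumes "X \<subseteq> E"
  shows "\<exists>Y. flat Y \<and> X \<subseteq> Y \<and> r Y = r X \<and> (\<forall>G. flat G \<and> X \<subseteq> G \<longrightarrow> Y \<subseteq> G)"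
proof -
  let ?S = "{Y. X \<subseteq> Y \<and> Y \<subseteq> E \<and> r Y = r X}"
  have "finite ?S" by (rule finite_subset[of _ "Pow E"]) auto
  moreover have "X \<in> ?S" using assms by simp
  ultimately obtain Y where Y: "Y \<in> ?S" and max: "\<And>Z. Z \<in> ?S \<Longrightarrow> Y \<subseteq> Z \<Longrightarrow> Y = Z"
    using finite_has_maximal2[of ?S X] by (metis (no_types, lifting))
  have "flat Y"
    unfolding is_flat_def
  proof (intro conjI ballI)
    fix x assume x: "x \<in> E - Y"
    have "r Y \<le> r (insert x Y)" using x Y by (intro rank_mono) auto
    moreover have "r (insert x Y) \<noteq> r Y" using max[of "insert x Y"] x Y by auto
    ultimately show "r Y < r (insert x Y)" by simp
  qed (use Y in auto)
  moreover have "Y \<subseteq> G" if G: "flat G" "X \<subseteq> G" for G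
  proof (rule ccontr)
    assume "\<not> Y \<subseteq> G"
    then have "r G < r (G \<union> Y)"
      using G Y flat_subset[OF G(1)] by (intro flat_rank_less) auto
    moreover have "r (G \<union> Y) + r (G \<inter> Y) \<le> r G + r Y"
      using Y flat_subset[OF G(1)] by (intro rank_submod) auto
    moreover have "r X \<le> r (G \<inter> Y)" using Y G by (intro rank_mono) auto
    ultimately show False using Y by simp
  qed
  ultimately show ?thesis using Y by blast
qed

definition cl :: "nat set \<Rightarrow> nat set" where
  "cl X = (SOME Y. flat Y \<and> X \<subseteq> Y \<and> r Y = r X \<and> (\<forall>G. flat G \<and> X \<subseteq> G \<longrightarrow> Y \<subseteq> G))"

lemma cl_props:
  assumes "X \<subseteq> E"
  shows flat_cl: "flat (cl X)" and subset_cl: "X \<subseteq> cl X" and rank_cl: "r (cl X) = r X"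
    and cl_minimal: "flat G \<Longrightarrow> X \<subseteq> G \<Longrightarrow> cl X \<subseteq> G"
  using someI_ex[OF closure_exists[OF assms]] unfolding cl_def by blast+

text \<open>\<open>Z\<close> is the preimage of the Chow ideal in the ring of polynomials in all variables,
  so that the computations modulo the ideal need no carrier conditions.\<close>

definition retract :: "poly \<Rightarrow> poly" where
  "retract = subst (\<lambda>S. if S \<in> PF then Var S else 0)"

definition Z :: "poly set" where
  "Z = {p. retract p \<in> chow_matroid_ideal E r}"

lemma chow_matroid_gens_subset: "chow_matroid_gens E r \<subseteq> polys_in PF"
  unfolding chow_matroid_gens_def
  by (auto intro!: polys_in_mult polys_in_diff polys_in_sum)

lemmas chow_ideal_props =
  genideal_props[OF chow_matroid_gens_subset, folded chow_matroid_ideal_def]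

lemma retract_in: "retract p \<in> polys_in PF"
  unfolding retract_def by (rule subst_in_polys_in) auto

lemma retract_id: "p \<in> polys_in PF \<Longrightarrow> retract p = p"
  unfolding retract_def by (rule subst_id_on) auto

lemma Z_0 [simp]: "0 \<in> Z"
  using chow_ideal_props(3) by (simp add: Z_def retract_def)

lemma Z_add: "p \<in> Z \<Longrightarrow> q \<in> Z \<Longrightarrow> p + q \<in> Z"
  using chow_ideal_props(4) by (simp add: Z_def retract_def subst_add)

lemma Z_mult: "p \<in> Z \<Longrightarrow> q * p \<in> Z"
  using chow_ideal_props(5)[of "retract p" "retract q"] retract_in
  by (simp add: Z_def retract_def subst_mult)

lemma Z_mult_right: "p \<in> Z \<Longrightarrow> p * q \<in> Z"
  using Z_mult[of p q] by (simp add: mult.commute)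

lemma Z_uminus: "p \<in> Z \<Longrightarrow> - p \<in> Z"
  using Z_mult[of p "- 1"] by simp

lemma Z_diff: "p \<in> Z \<Longrightarrow> q \<in> Z \<Longrightarrow> p - q \<in> Z"
  using Z_add[of p "- q"] Z_uminus by simp

lemma Z_sum: "(\<And>a. a \<in> A \<Longrightarrow> g a \<in> Z) \<Longrightarrow> sum g A \<in> Z"
  by (induction A rule: infinite_finite_induct) (auto simp: Z_add)

lemma ideal_subset_Z: "chow_matroid_ideal E r \<subseteq> Z"
proof
  fix p assume p: "p \<in> chow_matroid_ideal E r"
  then have "retract p = p" using chow_ideal_props(2) by (intro retract_id) auto
  then show "p \<in> Z" using p by (simp add: Z_def)
qed

lemma Z_polys_in: "p \<in> polys_in PF \<Longrightarrow> p \<in> Z \<longleftrightarrow> p \<in> chow_matroid_ideal E r"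
  by (simp add: Z_def retract_id)

lemma Z_Var: "S \<notin> PF \<Longrightarrow> Var S \<in> Z"
  using chow_ideal_props(3) by (simp add: Z_def retract_def)

lemma Z_incomparable:
  assumes "\<not> F \<subseteq> G" "\<not> G \<subseteq> F"
  shows "Var F * Var G \<in> Z"
proof (cases "F \<in> PF \<and> G \<in> PF")
  case True
  then have "Var F * Var G \<in> chow_matroid_gens E r"
    using assms unfolding chow_matroid_gens_def by blast
  then show ?thesis using chow_ideal_props(1) ideal_subset_Z by blast
next
  case False
  then show ?thesis using Z_Var Z_mult Z_mult_right by blast
qed

lemma Z_linear:
  assumes "i \<in> E" "j \<in> E"
  shows "(\<Sum>F\<in>{F \<in> PF. i \<in> F}. Var F) - (\<Sum>F\<in>{F \<in> PF. j \<in> F}. Var F) \<in> Z"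
proof -
  have "(\<Sum>F\<in>{F \<in> PF. i \<in> F}. Var F) - (\<Sum>F\<in>{F \<in> PF. j \<in> F}. Var F) \<in> chow_matroid_gens E r"
    using assms unfolding chow_matroid_gens_def by blast
  then show ?thesis using chow_ideal_props(1) ideal_subset_Z by blast
qed

section \<open>Congruence modulo the Chow ideal and the simplicial generators\<close>

definition eqZ :: "poly \<Rightarrow> poly \<Rightarrow> bool" (infix "\<approx>" 50) where
  "p \<approx> q \<longleftrightarrow> p - q \<in> Z"

lemma eqZ_refl [simp]: "p \<approx> p"
  by (simp add: eqZ_def)

lemma eqZ_sym: "p \<approx> q \<Longrightarrow> q \<approx> p"
  unfolding eqZ_def using Z_uminus[of "p - q"] by simp

lemma eqZ_trans [trans]: "p \<approx> q \<Longrightarrow> q \<approx> s \<Longrightarrow> p \<approx> s"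
  unfolding eqZ_def using Z_add[of "p - q" "q - s"] by simp

lemma eqZ_mult: "p \<approx> q \<Longrightarrow> s * p \<approx> s * q"
  unfolding eqZ_def using Z_mult[of "p - q" s] by (simp add: algebra_simps)

lemma eqZ_mult_right: "p \<approx> q \<Longrightarrow> p * s \<approx> q * s"
  using eqZ_mult[of p q s] by (simp add: mult.commute)

lemma eqZ_in_Z: "p \<approx> q \<Longrightarrow> p \<in> Z \<longleftrightarrow> q \<in> Z"
  unfolding eqZ_def using Z_add[of "p - q" q] Z_diff[of p "p - q"] by auto

text \<open>The choice of the element 0 in \<open>alpha\<close> is immaterial modulo \<open>Z\<close>.\<close>

definition alpha :: poly where
  "alpha = (\<Sum>F\<in>{F \<in> PF. 0 \<in> F}. Var F)"

text \<open>These are the simplicial generators of the Chow ring. No proper flat contains E, so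
  \<open>h E\<close> is \<open>alpha\<close>.\<close>

definition h :: "nat set \<Rightarrow> poly" where
  "h G = alpha - (\<Sum>F\<in>{F \<in> PF. G \<subseteq> F}. Var F)"

text \<open>When \<open>alpha\<close> is taken at a point i of G, every flat above G contains i and
  cancels. What remains has only positive coefficients.\<close>

lemma h_eqZ:
  assumes "i \<in> G" "i \<in> E"
  shows "h G \<approx> (\<Sum>H\<in>{H \<in> PF. i \<in> H \<and> \<not> G \<subseteq> H}. Var H)"
proof -
  have "(\<Sum>F\<in>{F \<in> PF. i \<in> F}. Var F) =
      (\<Sum>F\<in>{F \<in> PF. G \<subseteq> F}. Var F) + (\<Sum>H\<in>{H \<in> PF. i \<in> H \<and> \<not> G \<subseteq> H}. Var H)"
    using assms by (subst sum.union_disjoint[symmetric]) (auto intro!: sum.cong)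
  then show ?thesis
    using Z_linear[of 0 i] assms by (simp add: eqZ_def h_def alpha_def algebra_simps)
qed

lemma h_diff:
  assumes "F \<subseteq> K"
  shows "h F - h K = - (\<Sum>H\<in>{H \<in> PF. F \<subseteq> H \<and> \<not> K \<subseteq> H}. Var H)"
proof -
  have "(\<Sum>H\<in>{H \<in> PF. F \<subseteq> H}. Var H) =
      (\<Sum>H\<in>{H \<in> PF. K \<subseteq> H}. Var H) + (\<Sum>H\<in>{H \<in> PF. F \<subseteq> H \<and> \<not> K \<subseteq> H}. Var H)"
    using assms by (subst sum.union_disjoint[symmetric]) (auto intro!: sum.cong)
  then show ?thesis by (simp add: h_def algebra_simps)
qed

text \<open>The claim is \<open>(h F - h K) * (h G - h K) \<in> Z\<close>. The differences are sums
  over flats above F, respectively G, that do not contain K. Two such flats are incomparable: the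
  larger of two comparable ones would contain both F and G, hence K.\<close>

lemma h_quadratic:
  assumes "F \<subseteq> E" "G \<subseteq> E"
  defines "K \<equiv> cl (F \<union> G)"
  shows "h F * h G \<approx> h F * h K + h G * h K - h K * h K"
proof -
  have FG: "F \<union> G \<subseteq> E" using assms by auto
  have sub: "F \<subseteq> K" "G \<subseteq> K" using subset_cl[OF FG] by (auto simp: K_def)
  have K: "K \<subseteq> H" if "H \<in> PF" "F \<subseteq> H" "G \<subseteq> H" for H
    using cl_minimal[OF FG, of H] that by (auto simp: K_def PF_iff)
  have "(h F - h K) * (h G - h K) = (\<Sum>H\<in>{H \<in> PF. F \<subseteq> H \<and> \<not> K \<subseteq> H}. \<Sum>H'\<in>{H \<in> PF. G \<subseteq> H \<and> \<not> K \<subseteq> H}. Var H * Var H')"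
    by (simp add: h_diff sub sum_product)
  also have "\<dots> \<in> Z"
    using K by (intro Z_sum Z_incomparable) auto
  finally show ?thesis by (simp add: eqZ_def algebra_simps)
qed

definition subspace :: "(poly \<Rightarrow> bool) \<Rightarrow> bool" where
  "subspace P \<longleftrightarrow> P 0 \<and> (\<forall>p q. P p \<longrightarrow> P q \<longrightarrow> P (p + q)) \<and> (\<forall>c p. P p \<longrightarrow> P (Const c * p))"

lemma subspace_0: "subspace P \<Longrightarrow> P 0"
  and subspace_add: "subspace P \<Longrightarrow> P p \<Longrightarrow> P q \<Longrightarrow> P (p + q)"
  and subspace_Const: "subspace P \<Longrightarrow> P p \<Longrightarrow> P (Const c * p)"
  by (auto simp: subspace_def)

lemma subspace_uminus: "subspace P \<Longrightarrow> P p \<Longrightarrow> P (- p)"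
  using subspace_Const[of P p "- 1"] by (simp add: Const_uminus)

lemma subspace_diff: "subspace P \<Longrightarrow> P p \<Longrightarrow> P q \<Longrightarrow> P (p - q)"
  using subspace_add[of P p "- q"] subspace_uminus[of P q] by simp

lemma subspace_sum: "subspace P \<Longrightarrow> (\<And>a. a \<in> A \<Longrightarrow> P (g a)) \<Longrightarrow> P (sum g A)"
  by (induction A rule: infinite_finite_induct) (auto intro: subspace_0 subspace_add)

text \<open>This exchanges \<open>x_F\<close> for \<open>- h F\<close> at the cost of terms
  \<open>h K\<close> with larger K: \<open>Var F + h F\<close> equals \<open>h E\<close> minus the
  variables of the flats above F, and these are treated in the same way, descending from E.\<close>

lemma Var_plus_h_subspace:
  assumes P: "subspace P" and "F \<in> PF"
    and "\<And>K. K \<in> NF \<Longrightarrow> F \<subset> K \<Longrightarrow> P (h K * q)"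
  shows "P ((Var F + h F) * q)"
  using assms(2,3)
proof (induction "card (E - F)" arbitrary: F rule: less_induct)
  case less
  have F: "F \<subset> E" using less.prems(1) PF_subset_E[of F] PF_iff[of F] by blast
  have "(\<Sum>G\<in>{G \<in> PF. F \<subseteq> G}. Var G) = Var F + (\<Sum>G\<in>{G \<in> PF. F \<subset> G}. Var G)"
  proof -
    have "{G \<in> PF. F \<subseteq> G} = insert F {G \<in> PF. F \<subset> G}" using less.prems(1) by auto
    then show ?thesis by simp
  qed
  moreover have empty: "{G \<in> PF. E \<subseteq> G} = {}"
    using PF_subset_E by (auto simp: PF_iff dest: subset_antisym)
  ultimately have "h F = alpha - (Var F + (\<Sum>G\<in>{G \<in> PF. F \<subset> G}. Var G))" "h E = alpha"
    by (simp_all only: h_def empty sum.empty diff_zero)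
  then have eq: "(Var F + h F) * q = h E * q - (\<Sum>G\<in>{G \<in> PF. F \<subset> G}. Var G * q)"
    by (simp add: sum_distrib_right[symmetric] left_diff_distrib)
  have "P (Var G * q)" if G: "G \<in> PF" "F \<subset> G" for G
  proof -
    have "card (E - G) < card (E - F)"
      using G PF_subset_E[OF G(1)] by (intro psubset_card_mono) auto
    then have "P ((Var G + h G) * q)"
      using G by (intro less.hyps less.prems(2)) auto
    moreover have "P (h G * q)" using G PF_subset_NF by (intro less.prems(2)) auto
    ultimately show ?thesis
      using subspace_diff[OF P, of "(Var G + h G) * q" "h G * q"] by (simp add: algebra_simps)
  qed
  moreover have "P (h E * q)" using F E_NF by (intro less.prems(2)) auto
  ultimately show ?case unfolding eq by (intro subspace_diff[OF P] subspace_sum[OF P]) auto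
qed

section \<open>Vanishing products of the simplicial generators\<close>

definition hm :: "nat set multiset \<Rightarrow> poly" where
  "hm M = prod_mset (image_mset h M)"

lemma hm_simps [simp]: "hm {#} = 1" "hm (add_mset G M) = h G * hm M" "hm (M + N) = hm M * hm N"
  by (auto simp: hm_def)

lemma hm_replicate [simp]: "hm (replicate_mset k G) = h G ^ k"
  by (induction k) auto

definition chain_mset :: "nat set multiset \<Rightarrow> bool" where
  "chain_mset M \<longleftrightarrow> is_chain (set_mset M)"

text \<open>Reading the variable of the empty flat as 1 lets inductions along flags start at the
  empty flat.\<close>

definition X :: "nat set \<Rightarrow> poly" where
  "X F = (if F = {} then 1 else Var F)"

lemma X_Var_Z: "\<not> F \<subseteq> H \<Longrightarrow> \<not> H \<subseteq> F \<Longrightarrow> X F * Var H \<in> Z"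
  using Z_incomparable by (auto simp: X_def)

lemma chain_mset_min:
  assumes "chain_mset N" "N \<noteq> {#}"
  shows "\<exists>G N'. N = add_mset G N' \<and> chain_mset N' \<and> (\<forall>H\<in>#N'. G \<subseteq> H)"
proof -
  obtain G where G: "G \<in> set_mset N" and min: "\<And>H. H \<in> set_mset N \<Longrightarrow> H \<subseteq> G \<Longrightarrow> G = H"
    using finite_has_minimal[of "set_mset N"] assms(2) by auto
  have le: "G \<subseteq> H" if "H \<in># N" for H
    using assms(1) G that min[OF that] unfolding chain_mset_def is_chain_def by blast
  obtain N' where N': "N = add_mset G N'" using G by (metis multi_member_split)
  then show ?thesis
    using assms(1) le unfolding chain_mset_def is_chain_def
    by (intro exI[of _ G] exI[of _ N']) auto
qed

text \<open>Expanding the smallest factor by \<open>h_eqZ\<close> at an element outside \<open>F\<close> only produces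
  flats above \<open>F\<close> that contain no further member of the chain, so the remaining
  factors can be treated in the same way.\<close>

lemma hm_chain_vanish:
  assumes "flat F" "chain_mset N" "N \<noteq> {#}"
    and "\<And>G. G \<in># N \<Longrightarrow> G \<subseteq> K \<and> \<not> G \<subseteq> F" and "K \<subseteq> E"
    and "r (F \<union> K) \<le> r F + size N"
  shows "X F * hm N \<in> Z"
  using assms
proof (induction "size N" arbitrary: F N)
  case 0
  then show ?case by simp
next
  case (Suc k)
  obtain G N' where N: "N = add_mset G N'" "chain_mset N'" "\<And>H. H \<in># N' \<Longrightarrow> G \<subseteq> H"
    using chain_mset_min[OF Suc.prems(2,3)] by metis
  obtain i where i: "i \<in> G" "i \<notin> F" using Suc.prems(4)[of G] N(1) by auto
  have GK: "G \<subseteq> K" using Suc.prems(4) N(1) by auto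
  then have iE: "i \<in> E" "i \<in> K" using i Suc.prems(5) by auto
  let ?S = "{H \<in> PF. i \<in> H \<and> \<not> G \<subseteq> H}"
  have "X F * Var H * hm N' \<in> Z" if H: "H \<in> ?S" for H
  proof (cases "F \<subseteq> H")
    case False
    then show ?thesis using H i by (intro Z_mult_right X_Var_Z) auto
  next
    case True
    have Hf: "flat H" "H \<noteq> {}" "H \<subseteq> E" using H PF_subset_E by (auto simp: PF_iff)
    have FE: "F \<subseteq> E" using Suc.prems(1) flat_subset by blast
    \<comment> \<open>\<open>H \<inter> (F \<union> K)\<close> contains i besides F, so its rank
      exceeds \<open>r F\<close>. Passing from F to H thus lowers the gap
      \<open>r (F \<union> K) - r F\<close> by at least one, which pays for the factor G that was
      removed.\<close>
    have "r (H \<union> (F \<union> K)) + r (H \<inter> (F \<union> K)) \<le> r H + r (F \<union> K)"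
      using Hf FE Suc.prems(5) by (intro rank_submod) auto
    moreover have "r F < r (H \<inter> (F \<union> K))"
      using True H i iE Hf Suc.prems(1) by (intro flat_rank_less) auto
    moreover have "H \<union> (F \<union> K) = H \<union> K" using True by auto
    ultimately have rk: "r (H \<union> K) \<le> r H + size N'"
      using Suc.prems(6) N(1) by simp
    \<comment> \<open>An empty rest is impossible: \<open>rk\<close> would then give
      \<open>r (H \<union> K) \<le> r H\<close>, although H is a flat not containing K.\<close>
    have "\<not> K \<subseteq> H" using H GK by auto
    then have "r H < r (H \<union> K)" using Hf Suc.prems(5) by (intro flat_rank_less) auto
    then have "N' \<noteq> {#}" using rk by auto
    then have "X H * hm N' \<in> Z"
    proof (intro Suc.hyps(1))
      show "L \<subseteq> K \<and> \<not> L \<subseteq> H" if "L \<in># N'" for L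
        using Suc.prems(4)[of L] N(1) N(3)[OF that] H that by auto
    qed (use N Suc.prems rk Suc.hyps(2) Hf in auto)
    then show ?thesis
      using Z_mult[of "X H * hm N'" "X F"] Hf by (simp add: X_def mult.assoc)
  qed
  then have "(\<Sum>H\<in>?S. X F * Var H * hm N') \<in> Z" by (rule Z_sum)
  moreover have "h G * (X F * hm N') \<approx> (\<Sum>H\<in>?S. Var H) * (X F * hm N')"
    using i iE by (intro eqZ_mult_right h_eqZ)
  moreover have "h G * (X F * hm N') = X F * hm N"
    "(\<Sum>H\<in>?S. Var H) * (X F * hm N') = (\<Sum>H\<in>?S. X F * Var H * hm N')"
    unfolding N(1) by (simp_all add: mult_ac sum_distrib_left sum_distrib_right)
  ultimately show ?case using eqZ_in_Z by auto
qed

lemma not_chain_mset_split: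
  assumes "\<not> chain_mset N"
  shows "\<exists>F G N'. N = add_mset F (add_mset G N') \<and> \<not> F \<subseteq> G \<and> \<not> G \<subseteq> F"
proof -
  obtain F G where FG: "F \<in># N" "G \<in># N" "\<not> F \<subseteq> G" "\<not> G \<subseteq> F"
    using assms unfolding chain_mset_def is_chain_def by blast
  obtain N1 where N1: "N = add_mset F N1" using FG by (metis multi_member_split)
  then have "G \<in># N1" using FG by auto
  then obtain N' where "N1 = add_mset G N'" by (metis multi_member_split)
  then show ?thesis using FG N1 by blast
qed

text \<open>Termination measure for straightening, in which factors are replaced by those of larger
  flats.\<close>

definition corank_sum :: "nat set multiset \<Rightarrow> nat" where
  "corank_sum M = (\<Sum>G\<in>#M. d + 1 - r G)"

lemma corank_sum_simps [simp]:
  "corank_sum {#} = 0" "corank_sum (add_mset G M) = d + 1 - r G + corank_sum M"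
  "corank_sum (M + N) = corank_sum M + corank_sum N"
  by (auto simp: corank_sum_def)

lemma cl_Un_greater:
  assumes "flat F" "flat G" "\<not> F \<subseteq> G" "\<not> G \<subseteq> F"
  shows "flat (cl (F \<union> G))" "F \<subset> cl (F \<union> G)" "G \<subset> cl (F \<union> G)"
    "r F < r (cl (F \<union> G))" "r G < r (cl (F \<union> G))" "r (cl (F \<union> G)) \<le> d + 1"
proof -
  have E: "F \<union> G \<subseteq> E" using assms flat_subset by auto
  show 1: "flat (cl (F \<union> G))" using flat_cl[OF E] .
  show 2: "F \<subset> cl (F \<union> G)" "G \<subset> cl (F \<union> G)" using subset_cl[OF E] assms by auto
  show "r F < r (cl (F \<union> G))" "r G < r (cl (F \<union> G))" "r (cl (F \<union> G)) \<le> d + 1"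
    using flat_rank_less[OF assms(1) flat_subset[OF 1] 2(1)]
      flat_rank_less[OF assms(2) flat_subset[OF 1] 2(2)] flat_rank_le[OF 1] by auto
qed

lemma hm_split_eqZ:
  assumes "F \<subseteq> E" "G \<subseteq> E"
  defines "K \<equiv> cl (F \<union> G)"
  shows "hm (add_mset F (add_mset G N)) \<approx>
    hm (add_mset F (add_mset K N)) + hm (add_mset G (add_mset K N)) - hm (add_mset K (add_mset K N))"
  using eqZ_mult_right[OF h_quadratic[OF assms(1,2)], of "hm N"]
  by (simp add: K_def algebra_simps)

text \<open>The quadratic relation reduces this to chains. All hypotheses survive the replacement of
  A or B by the closure C of their union: the number of factors is kept, C stays inside K because K
  is a flat, and C is not inside F because A is not.\<close>

lemma hm_vanish:
  assumes "flat F" "flat K" "N \<noteq> {#}"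
    and "\<And>G. G \<in># N \<Longrightarrow> G \<in> NF \<and> G \<subseteq> K \<and> \<not> G \<subseteq> F"
    and "r (F \<union> K) \<le> r F + size N"
  shows "X F * hm N \<in> Z"
  using assms(3-)
proof (induction "corank_sum N" arbitrary: N rule: less_induct)
  case less
  show ?case
  proof (cases "chain_mset N")
    case True
    then show ?thesis
      using hm_chain_vanish[OF assms(1) True less.prems(1), of K] less.prems flat_subset[OF assms(2)]
      by auto
  next
    case False
    then obtain A B N' where N: "N = add_mset A (add_mset B N')" and AB: "\<not> A \<subseteq> B" "\<not> B \<subseteq> A"
      using not_chain_mset_split by blast
    define C where "C = cl (A \<union> B)"
    have fl: "flat A" "flat B" using less.prems(2) N by (auto simp: NF_iff)
    note C = cl_Un_greater[OF fl AB, folded C_def]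
    have "C \<subseteq> K" unfolding C_def
      using less.prems(2) N fl flat_subset assms(2) by (intro cl_minimal) auto
    have in_Z: "X F * hm M \<in> Z"
      if "M \<in> {add_mset A (add_mset C N'), add_mset B (add_mset C N'), add_mset C (add_mset C N')}" for M
    proof (rule less.hyps)
      show "corank_sum M < corank_sum N" using that C(4-6) unfolding N by auto
      show "M \<noteq> {#}" using that by auto
      have "size M = size N" using that N by auto
      then show "r (F \<union> K) \<le> r F + size M" using less.prems(3) by simp
      have "C \<in> NF \<and> C \<subseteq> K \<and> \<not> C \<subseteq> F"
        using C(1,2) less.prems(2)[of A] N \<open>C \<subseteq> K\<close> by (auto simp: NF_iff)
      moreover have "G = A \<or> G = B \<or> G = C \<or> G \<in># N'" if "G \<in># M" for G
        using that \<open>M \<in> _\<close> by auto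
      moreover have "A \<in># N" "B \<in># N" "\<And>G. G \<in># N' \<Longrightarrow> G \<in># N" using N by auto
      ultimately show "G \<in> NF \<and> G \<subseteq> K \<and> \<not> G \<subseteq> F" if "G \<in># M" for G
        using less.prems(2)[of G] that by metis
    qed
    let ?AC = "add_mset A (add_mset C N')" and ?BC = "add_mset B (add_mset C N')"
      and ?CC = "add_mset C (add_mset C N')"
    have "X F * hm N \<approx> X F * (hm ?AC + hm ?BC - hm ?CC)"
      unfolding N C_def using fl flat_subset by (intro eqZ_mult hm_split_eqZ) auto
    moreover have "X F * (hm ?AC + hm ?BC - hm ?CC) = X F * hm ?AC + X F * hm ?BC - X F * hm ?CC"
      by (simp only: ring_distribs)
    moreover have "X F * hm ?AC + X F * hm ?BC - X F * hm ?CC \<in> Z"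
      by (intro Z_add Z_diff in_Z) simp_all
    ultimately show ?thesis using eqZ_in_Z by auto
  qed
qed

text \<open>In a chain the union of the members below G is the predecessor of G, and for the
  smallest member F takes its place. The condition says that each exponent is smaller than the rank
  gap to the predecessor.\<close>

definition nested :: "nat set \<Rightarrow> nat set multiset \<Rightarrow> bool" where
  "nested F M \<longleftrightarrow> chain_mset M \<and>
     (\<forall>G\<in>#M. G \<in> NF \<and> F \<subset> G \<and> count M G + r (F \<union> \<Union>{H \<in> set_mset M. H \<subset> G}) < r G)"

section \<open>A triangular spanning set\<close>

lemma h_power_vanish:
  assumes "flat F" "G \<in> NF" "\<not> G \<subseteq> F" "0 < k" "r (F \<union> G) \<le> r F + k"
  shows "X F * h G ^ k \<in> Z"
proof -
  have "X F * hm (replicate_mset k G) \<in> Z"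
    using assms by (intro hm_vanish[of F G]) (simp_all add: NF_iff in_replicate_mset)
  then show ?thesis by simp
qed

lemma nestedD:
  assumes "nested F M" "G \<in># M" "\<And>H. H \<in># M \<Longrightarrow> \<not> H \<subset> G"
  shows "count M G + r F < r G"
proof -
  have "{H \<in> set_mset M. H \<subset> G} = {}" using assms(3) by blast
  moreover have "count M G + r (F \<union> \<Union>{H \<in> set_mset M. H \<subset> G}) < r G"
    using assms(1,2) unfolding nested_def by blast
  ultimately show ?thesis by (simp only: Union_empty Un_empty_right)
qed

lemma PF_rank: "F \<in> PF \<Longrightarrow> r F \<le> d"
proof -
  assume F: "F \<in> PF"
  then have "flat F" "F \<subset> E" using PF_subset_E[of F] PF_iff[of F] by blast+
  then show "r F \<le> d" using flat_rank_less[of F E] rank_E by simp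
qed

section \<open>Spanning by nested products\<close>

inductive spanned :: "poly \<Rightarrow> bool" where
  Z: "p \<in> Z \<Longrightarrow> spanned p"
| step: "nested {} M \<Longrightarrow> spanned p \<Longrightarrow> spanned (Const c * hm M + p)"

lemma spanned_add: "spanned p \<Longrightarrow> spanned q \<Longrightarrow> spanned (p + q)"
proof (induction p rule: spanned.induct)
  case (Z p)
  from \<open>spanned q\<close> \<open>p \<in> Z\<close> show ?case
  proof (induction q rule: spanned.induct)
    case (Z q)
    then show ?case by (intro spanned.Z Z_add)
  next
    case (step M q c)
    then have "spanned (Const c * hm M + (p + q))" by (intro spanned.step)
    then show ?case by (simp add: algebra_simps)
  qed
next
  case (step M p c)
  then have "spanned (Const c * hm M + (p + q))" by (intro spanned.step)
  then show ?case by (simp add: algebra_simps)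
qed

lemma spanned_Const: "spanned p \<Longrightarrow> spanned (Const a * p)"
proof (induction p rule: spanned.induct)
  case (Z p)
  then show ?case by (intro spanned.Z Z_mult)
next
  case (step M p c)
  then have "spanned (Const (a * c) * hm M + Const a * p)" by (intro spanned.step)
  then show ?case by (simp add: algebra_simps Const_mult)
qed

lemma subspace_spanned: "subspace spanned"
  unfolding subspace_def using spanned_add spanned_Const spanned.Z Z_0 by blast

lemma spanned_nested: "nested {} M \<Longrightarrow> spanned (hm M)"
  using spanned.step[of M 0 1] spanned.Z[OF Z_0] by simp

lemma spanned_eqZ: "p \<approx> q \<Longrightarrow> spanned q \<Longrightarrow> spanned p"
  using spanned_add[of q "p - q"] spanned.Z[of "p - q"] by (simp add: eqZ_def)

lemma mset_split_replicate: "M = replicate_mset (count M G) G + {#H \<in># M. H \<noteq> G#}"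
  using multiset_partition[of M "\<lambda>H. H = G"] by (simp add: filter_eq_replicate_mset)

lemma Union_chain_in:
  assumes "finite C" "is_chain C" "C \<noteq> {}"
  shows "\<Union>C \<in> C"
proof -
  obtain G where G: "G \<in> C" and max: "\<And>H. H \<in> C \<Longrightarrow> G \<subseteq> H \<Longrightarrow> G = H"
    using finite_has_maximal[OF assms(1,3)] by metis
  have "H \<subseteq> G" if "H \<in> C" for H
    using assms(2) G that max[OF that] unfolding is_chain_def by blast
  then have "\<Union>C = G" using G by blast
  then show ?thesis using G by simp
qed

text \<open>Straightening moves factors up towards E. A pair of incomparable factors is treated by
  the quadratic relation. In a chain whose exponent b at G is too large, \<open>h G ^ b\<close>
  vanishes if G is smallest. Otherwise it is killed by the variable of the predecessor, so that one
  factor of the predecessor can be traded for larger flats.\<close>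

lemma spanned_hm:
  assumes "\<And>G. G \<in># M \<Longrightarrow> G \<in> NF"
  shows "spanned (hm M)"
  using assms
proof (induction "corank_sum M" arbitrary: M rule: less_induct)
  case less
  consider "\<not> chain_mset M" | "chain_mset M" "nested {} M" | "chain_mset M" "\<not> nested {} M" by blast
  then show ?case
  proof cases
    case 1
    then obtain A B N where M: "M = add_mset A (add_mset B N)" and AB: "\<not> A \<subseteq> B" "\<not> B \<subseteq> A"
      using not_chain_mset_split by blast
    define C where "C = cl (A \<union> B)"
    have fl: "flat A" "flat B" using less.prems[of A] less.prems[of B] M by (auto simp: NF_iff)
    note C = cl_Un_greater[OF fl AB, folded C_def]
    have "C \<in> NF" using C by (auto simp: NF_iff)
    have *: "spanned (hm L)"
      if "L \<in> {add_mset A (add_mset C N), add_mset B (add_mset C N), add_mset C (add_mset C N)}" for L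
    proof (rule less.hyps)
      show "corank_sum L < corank_sum M" using that C(4-6) unfolding M by auto
      have "A \<in># M" "B \<in># M" "\<And>G. G \<in># N \<Longrightarrow> G \<in># M" using M by auto
      moreover have "G = A \<or> G = B \<or> G = C \<or> G \<in># N" if "G \<in># L" for G
        using that \<open>L \<in> _\<close> by auto
      ultimately show "G \<in> NF" if "G \<in># L" for G
        using that less.prems \<open>C \<in> NF\<close> by metis
    qed
    have "hm M \<approx> hm (add_mset A (add_mset C N)) + hm (add_mset B (add_mset C N)) - hm (add_mset C (add_mset C N))"
      unfolding M C_def using fl flat_subset by (intro hm_split_eqZ) auto
    then show ?thesis
      by (rule spanned_eqZ)
         (intro subspace_diff[OF subspace_spanned] spanned_add *, simp_all)
  next
    case 2
    show ?thesis by (rule spanned_nested[OF 2(2)])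
  next
    case 3
    define U where "U G = \<Union>{H \<in> set_mset M. H \<subset> G}" for G
    have "\<exists>G\<in>#M. \<not> (G \<in> NF \<and> {} \<subset> G \<and> count M G + r ({} \<union> U G) < r G)"
      using 3 unfolding nested_def U_def by blast
    then obtain G where "G \<in># M" "\<not> (G \<in> NF \<and> {} \<subset> G \<and> count M G + r ({} \<union> U G) < r G)"
      by blast
    moreover from this have "G \<in> NF" "{} \<subset> G" using less.prems by (auto simp: NF_iff)
    ultimately have G: "G \<in># M" "r G \<le> count M G + r (U G)" by auto
    define b where "b = count M G"
    define N where "N = {#H \<in># M. H \<noteq> G#}"
    have M: "M = replicate_mset b G + N" using mset_split_replicate by (simp add: N_def b_def)
    have GNF: "G \<in> NF" using less.prems G by auto
    then have Gf: "flat G" "G \<noteq> {}" "G \<subseteq> E" using NF_subset_E[of G] by (auto simp: NF_iff)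
    have b0: "b > 0" using G(1) by (simp add: b_def)
    show ?thesis
    proof (cases "U G = {}")
      case True
      then have "X {} * h G ^ b \<in> Z"
        using Gf flat_empty G(2) b0 GNF by (intro h_power_vanish) (simp_all add: b_def)
      then show ?thesis unfolding M by (intro spanned.Z) (simp add: X_def Z_mult_right)
    next
      case False
      then have "{H \<in> set_mset M. H \<subset> G} \<noteq> {}" unfolding U_def by blast
      moreover have "is_chain {H \<in> set_mset M. H \<subset> G}"
        using 3 by (auto simp: chain_mset_def is_chain_def)
      ultimately have "U G \<in> {H \<in> set_mset M. H \<subset> G}"
        unfolding U_def by (intro Union_chain_in) auto
      then have U: "U G \<in># N" "U G \<subset> G" "U G \<in> NF" using less.prems by (auto simp: N_def)
      then obtain N' where N': "N = add_mset (U G) N'" by (metis multi_member_split)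
      have UPF: "U G \<in> PF" using U GNF Gf by (auto simp: PF_iff NF_iff)
      \<comment> \<open>q is the product without one factor \<open>h (U G)\<close>. As
        \<open>Var (U G) * q\<close> lies in Z, \<open>h (U G) * q\<close> agrees with
        \<open>(Var (U G) + h (U G)) * q\<close>, which involves only flats larger than
        \<open>U G\<close>.\<close>
      define q where "q = h G ^ b * hm N'"
      have "U G \<union> G = G" "\<not> G \<subseteq> U G" "flat (U G)" using U NF_iff by auto
      then have "X (U G) * h G ^ b \<in> Z"
        using G(2) b0 GNF by (intro h_power_vanish) (simp_all add: b_def)
      then have "Var (U G) * h G ^ b \<in> Z" using UPF by (simp add: X_def PF_iff)
      then have "Var (U G) * h G ^ b * hm N' \<in> Z" by (rule Z_mult_right)
      then have "spanned (Var (U G) * q)" by (intro spanned.Z) (simp add: q_def mult.assoc)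
      moreover have "spanned ((Var (U G) + h (U G)) * q)"
      proof (rule Var_plus_h_subspace[OF subspace_spanned UPF])
        fix K assume K: "K \<in> NF" "U G \<subset> K"
        have "r (U G) < r K" "r K \<le> d + 1"
          using K U NF_subset_E[of K] flat_rank_le by (auto intro!: flat_rank_less simp: NF_iff)
        then have "corank_sum (replicate_mset b G + add_mset K N') < corank_sum M"
          unfolding M N' corank_sum_simps by simp
        moreover have "L \<in> NF" if "L \<in># replicate_mset b G + add_mset K N'" for L
          using that GNF K less.prems[of L] by (auto simp: M N' split: if_splits)
        ultimately have "spanned (hm (replicate_mset b G + add_mset K N'))"
          by (rule less.hyps)
        then show "spanned (h K * q)" by (simp add: q_def mult_ac)
      qed
      ultimately have "spanned ((Var (U G) + h (U G)) * q - Var (U G) * q)"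
        by (intro subspace_diff[OF subspace_spanned])
      then show ?thesis unfolding M N' q_def by (simp add: algebra_simps)
    qed
  qed
qed

text \<open>\<open>Var S\<close> is \<open>- h S\<close> plus a combination of \<open>h K\<close>
  for larger K, and \<open>spanned_hm\<close> covers each of the resulting products.\<close>

lemma spanned_Var_mult: "spanned p \<Longrightarrow> spanned (Var S * p)"
proof (induction p rule: spanned.induct)
  case (Z p)
  then show ?case by (intro spanned.Z Z_mult)
next
  case (step M p c)
  have "spanned (Var S * hm M)"
  proof (cases "S \<in> PF")
    case True
    have M: "G \<in> NF" if "G \<in># M" for G using step.hyps that by (auto simp: nested_def)
    have *: "spanned (h K * hm M)" if "K \<in> NF" for K
      using spanned_hm[of "add_mset K M"] M that by auto
    have "spanned ((Var S + h S) * hm M - h S * hm M)"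
      using True PF_subset_NF * by (intro subspace_diff[OF subspace_spanned] Var_plus_h_subspace[OF subspace_spanned]) auto
    then show ?thesis by (simp add: algebra_simps)
  next
    case False
    then show ?thesis by (intro spanned.Z Z_mult_right Z_Var)
  qed
  then have "spanned (Const c * (Var S * hm M) + Var S * p)"
    by (intro spanned_add spanned_Const step.IH)
  then show ?case by (simp add: algebra_simps)
qed

lemma spanned_all: "spanned p"
proof (induction p rule: poly_induct)
  case one
  have "nested {} {#}" by (auto simp: nested_def chain_mset_def is_chain_def)
  then show ?case using spanned_nested by force
qed (auto intro: spanned_Var_mult spanned_Const spanned_add)

lemma nested_expansion:
  "\<exists>A c. finite A \<and> (\<forall>M\<in>A. nested {} M) \<and> p \<approx> (\<Sum>M\<in>A. Const (c M) * hm M)"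
  using spanned_all[of p]
proof (induction p rule: spanned.induct)
  case (Z p)
  then show ?case by (intro exI[of _ "{}"]) (auto simp: eqZ_def)
next
  case (step M p c)
  then obtain A a where A: "finite A" "\<forall>M\<in>A. nested {} M" "p \<approx> (\<Sum>M\<in>A. Const (a M) * hm M)"
    by blast
  \<comment> \<open>M may already occur in A, in which case the two coefficients add up.\<close>
  define a' where "a' = (\<lambda>L. (if L \<in> A then a L else 0) + (if L = M then c else 0))"
  have "(\<Sum>L\<in>insert M A. Const (a' L) * hm L) =
      (\<Sum>L\<in>insert M A. Const (if L \<in> A then a L else 0) * hm L) + (\<Sum>L\<in>insert M A. Const (if L = M then c else 0) * hm L)"
    by (simp only: a'_def Const_add ring_distribs sum.distrib)
  also have "(\<Sum>L\<in>insert M A. Const (if L \<in> A then a L else 0) * hm L) = (\<Sum>L\<in>A. Const (a L) * hm L)"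
    using A(1) by (intro sum.mono_neutral_cong_right) auto
  also have "(\<Sum>L\<in>insert M A. Const (if L = M then c else 0) * hm L) = (\<Sum>L\<in>{M}. Const c * hm L)"
    using A(1) by (intro sum.mono_neutral_cong_right) auto
  finally have "Const c * hm M + p \<approx> (\<Sum>L\<in>insert M A. Const (a' L) * hm L)"
    using A(3) by (simp add: eqZ_def)
  then show ?case using A step.hyps by (intro exI[of _ "insert M A"] exI[of _ a']) auto
qed

section \<open>Powers of the top generator\<close>

lemma Var_hE_vanish:
  assumes "H \<in> PF" "d + 1 \<le> r H + m"
  shows "Var H * h E ^ m \<in> Z"
proof -
  have H: "flat H" "H \<noteq> {}" "H \<subseteq> E" "H \<noteq> E" using assms PF_subset_E by (auto simp: PF_iff)
  then have "r H < d + 1" using flat_rank_less[of H E] rank_E by auto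
  then have "m > 0" using assms by simp
  have "X H * h E ^ m \<in> Z"
    using H assms \<open>m > 0\<close> E_NF rank_E by (intro h_power_vanish) (auto simp: sup.absorb2)
  then show ?thesis using H by (simp add: X_def)
qed

text \<open>\<open>h F - h E\<close> is minus a sum of variables of flats above F. Their coranks are
  at most m, so \<open>h E ^ m\<close> kills each of them.\<close>

lemma h_absorb:
  assumes "F \<in> NF" "d + 1 \<le> r F + m"
  shows "h F * h E ^ m \<approx> h E ^ Suc m"
proof -
  have F: "F \<subseteq> E" using assms NF_subset_E by auto
  have "Var H * h E ^ m \<in> Z" if H: "H \<in> PF" "F \<subseteq> H" for H
    using rank_mono[OF H(2)] PF_subset_E[OF H(1)] assms H by (intro Var_hE_vanish) auto
  then have "(\<Sum>H\<in>{H \<in> PF. F \<subseteq> H \<and> \<not> E \<subseteq> H}. Var H * h E ^ m) \<in> Z"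
    by (intro Z_sum) auto
  then have "(h F - h E) * h E ^ m \<in> Z"
    unfolding h_diff[OF F] using Z_uminus by (simp add: sum_distrib_right)
  then show ?thesis by (simp add: eqZ_def algebra_simps)
qed

lemma h_power_absorb:
  assumes "F \<in> NF" "d + 1 \<le> r F + m"
  shows "h F ^ j * h E ^ m \<approx> h E ^ (m + j)"
proof (induction j)
  case (Suc j)
  have "h F ^ Suc j * h E ^ m \<approx> h F * h E ^ (m + j)"
    using eqZ_mult[OF Suc.IH, of "h F"] by (simp add: mult.assoc)
  also have "\<dots> \<approx> h E ^ Suc (m + j)" using assms by (intro h_absorb) auto
  finally show ?case by simp
qed simp

lemma Var_eq:
  assumes "F \<in> PF"
  shows "Var F = h E - h F - (\<Sum>K\<in>{K \<in> PF. F \<subset> K}. Var K)"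
proof -
  have "{G \<in> PF. F \<subseteq> G} = insert F {G \<in> PF. F \<subset> G}" using assms by auto
  moreover have "{G \<in> PF. E \<subseteq> G} = {}"
    using PF_subset_E by (auto simp: PF_iff dest: subset_antisym)
  moreover have "sum Var (insert F {G \<in> PF. F \<subset> G}) = Var F + (\<Sum>K\<in>{K \<in> PF. F \<subset> K}. Var K)"
    by simp
  ultimately have "h F = alpha - (Var F + (\<Sum>K\<in>{K \<in> PF. F \<subset> K}. Var K))" "h E = alpha"
    by (simp_all only: h_def sum.empty diff_zero)
  then show ?thesis by simp
qed

text \<open>In \<open>Var G = h E - h G - (variables of larger flats)\<close> only
  \<open>h E\<close> survives: one more factor \<open>h G\<close> completes the rank gap between F
  and G, and the variables of larger flats die against \<open>h E ^ (d - r G)\<close>. The remaining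
  powers of \<open>h G\<close> then turn into powers of \<open>h E\<close>.\<close>

lemma Var_h_power_top:
  assumes F: "flat F" and G: "G \<in> PF" "F \<subset> G"
  shows "X F * h G ^ (r G - r F - 1) * (Var G * h E ^ (d - r G)) \<approx> X F * h E ^ (d - r F)"
proof -
  have Gf: "flat G" "G \<noteq> {}" "G \<subseteq> E" "G \<noteq> E" using G PF_subset_E by (auto simp: PF_iff)
  have rG: "r G \<le> d" using PF_rank[OF G(1)] .
  have rF: "r F < r G" using flat_rank_less F G Gf by auto
  define s where "s = r G - r F - 1"
  define q where "q = X F * h G ^ s * h E ^ (d - r G)"
  have "F \<union> G = G" using G(2) by auto
  then have "X F * h G ^ Suc s \<in> Z"
    using F G rF PF_subset_NF by (intro h_power_vanish) (auto simp: s_def)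
  then have hG: "h G * q \<in> Z"
    using Z_mult_right[of "X F * h G ^ Suc s" "h E ^ (d - r G)"]
    by (simp add: q_def mult_ac)
  have K: "Var K * q \<in> Z" if "K \<in> PF" "G \<subset> K" for K
  proof -
    have "r G < r K" using that Gf PF_subset_E by (intro flat_rank_less) auto
    then have "Var K * h E ^ (d - r G) \<in> Z" using that by (intro Var_hE_vanish) auto
    then show ?thesis
      using Z_mult[of "Var K * h E ^ (d - r G)" "X F * h G ^ s"] by (simp add: q_def mult_ac)
  qed
  have "Var G * q = h E * q - (h G * q + (\<Sum>K\<in>{K \<in> PF. G \<subset> K}. Var K * q))"
    by (subst Var_eq[OF G(1)]) (simp add: left_diff_distrib sum_distrib_right)
  moreover have "h G * q + (\<Sum>K\<in>{K \<in> PF. G \<subset> K}. Var K * q) \<in> Z"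
    using hG K by (intro Z_add Z_sum) auto
  ultimately have "h E * q \<approx> Var G * q" by (simp add: eqZ_def)
  then have "Var G * q \<approx> h E * q" by (rule eqZ_sym)
  also have "h E * q = X F * (h G ^ s * h E ^ (d - r G + 1))" by (simp add: q_def mult_ac)
  \<comment> \<open>The factor gained from \<open>Var G\<close> raises the exponent of
    \<open>h E\<close> to \<open>d + 1 - r G\<close>, exactly where absorption begins.\<close>
  also have "\<dots> \<approx> X F * h E ^ (d - r G + 1 + s)"
    using rG G PF_subset_NF by (intro eqZ_mult h_power_absorb) auto
  also have "d - r G + 1 + s = d - r F" using rG rF by (simp add: s_def)
  finally show ?thesis by (simp add: q_def s_def mult_ac)
qed

section \<open>Rank sums, flags and test elements\<close>

definition rank_sum :: "nat set multiset \<Rightarrow> nat" where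
  "rank_sum M = (\<Sum>G\<in>#M. r G)"

lemma rank_sum_simps [simp]:
  "rank_sum {#} = 0" "rank_sum (add_mset G M) = r G + rank_sum M"
  "rank_sum (M + N) = rank_sum M + rank_sum N" "rank_sum (replicate_mset k G) = k * r G"
  by (auto simp: rank_sum_def)

lemma rank_sum_bound:
  assumes "K \<subseteq> E" "\<And>G. G \<in># N \<Longrightarrow> G \<in> NF \<and> G \<subseteq> K"
  shows "rank_sum N \<le> size N * r K \<and> (rank_sum N = size N * r K \<longrightarrow> N = replicate_mset (size N) K)"
  using assms(2)
proof (induction N)
  case (add G N)
  have IH: "rank_sum N \<le> size N * r K" "rank_sum N = size N * r K \<Longrightarrow> N = replicate_mset (size N) K"
    using add by auto
  have G: "flat G" "G \<subseteq> K" using add.prems[of G] by (auto simp: NF_iff)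
  have le: "r G \<le> r K" using G assms(1) by (intro rank_mono)
  have "r G < r K" if "G \<noteq> K" using that G assms(1) by (intro flat_rank_less) auto
  then have "G = K" if "r G = r K" using that by auto
  then show ?case using IH le
    by (auto simp: add_mono)
qed simp

lemma chain_above_card:
  assumes "flat F" "C \<subseteq> {G \<in> PF. F \<subset> G}" "is_chain C"
  shows "card C \<le> d - r F"
proof -
  have "inj_on r C"
  proof (rule inj_onI, rule ccontr)
    fix G H assume GH: "G \<in> C" "H \<in> C" "r G = r H" "G \<noteq> H"
    then have "G \<subset> H \<or> H \<subset> G" using assms(3) unfolding is_chain_def by blast
    moreover have "flat G" "flat H" "G \<subseteq> E" "H \<subseteq> E"
      using GH assms(2) flat_subset by (auto simp: PF_iff)
    ultimately show False using flat_rank_less[of G H] flat_rank_less[of H G] GH(3) by auto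
  qed
  moreover have "r ` C \<subseteq> {r F<..d}"
  proof
    fix k assume "k \<in> r ` C"
    then obtain G where G: "G \<in> C" "k = r G" by blast
    then have "G \<in> PF" "F \<subset> G" using assms(2) by auto
    then show "k \<in> {r F<..d}"
      using flat_rank_less[of F G] PF_subset_E PF_rank[of G] assms(1) G(2) by auto
  qed
  ultimately have "card C \<le> card {r F<..d}" by (intro card_inj_on_le[of r]) auto
  then show ?thesis by simp
qed

text \<open>The smallest flat G is split off. In a full flag all rank gaps are 1, so
  \<open>Var_h_power_top\<close> applies with exponent 0 on \<open>h G\<close>.\<close>

lemma mono_flag:
  assumes "flat F" "C \<subseteq> {G \<in> PF. F \<subset> G}" "is_chain C" "card C = d - r F"
  shows "X F * mono C \<approx> X F * h E ^ (d - r F)"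
  using assms
proof (induction "card C" arbitrary: C F)
  case 0
  have "finite C" using 0 finite_subset[of C PF] by auto
  then have "C = {}" using 0 by simp
  then show ?case using 0 by (simp add: mono_def)
next
  case (Suc k)
  have fin: "finite C" using Suc finite_subset[of C PF] by auto
  moreover have "C \<noteq> {}" using Suc by auto
  ultimately obtain G where G: "G \<in> C" and min: "\<And>H. H \<in> C \<Longrightarrow> H \<subseteq> G \<Longrightarrow> G = H"
    using finite_has_minimal[of C] by metis
  have GP: "G \<in> PF" "F \<subset> G" using G Suc.prems by auto
  have Gf: "flat G" "G \<noteq> {}" "G \<subseteq> E" "G \<noteq> E" using GP PF_subset_E by (auto simp: PF_iff)
  have rk: "r F < r G" "r G \<le> d"
    using flat_rank_less[of F G] PF_rank Suc.prems(1) Gf GP by auto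
  have C': "C - {G} \<subseteq> {H \<in> PF. G \<subset> H}"
  proof
    fix H assume H: "H \<in> C - {G}"
    then have "\<not> H \<subseteq> G" using min by blast
    then have "G \<subset> H" using Suc.prems(3) G H unfolding is_chain_def by blast
    then show "H \<in> {H \<in> PF. G \<subset> H}" using H Suc.prems(2) by blast
  qed
  have ch: "is_chain (C - {G})" using Suc.prems(3) by (auto simp: is_chain_def)
  have card: "card (C - {G}) = k" using Suc.hyps(2) G fin by simp
  \<comment> \<open>The k remaining flats need k distinct ranks in \<open>{r G<..d}\<close>. Since
    \<open>k + 1 = d - r F\<close>, this forces \<open>r G = r F + 1\<close>.\<close>
  then have "k \<le> d - r G" using chain_above_card[OF Gf(1) C' ch] by simp
  then have eq: "r G = r F + 1" "k = d - r G" using Suc.hyps(2) Suc.prems(4) rk by auto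
  have "X F * mono C = X F * (X G * mono (C - {G}))"
    using fin G Gf by (simp add: mono_def X_def prod.remove)
  also have "\<dots> \<approx> X F * (X G * h E ^ (d - r G))"
    using eq(2) card by (intro eqZ_mult Suc.hyps(1)[OF card[symmetric] Gf(1) C' ch]) simp
  also have "\<dots> \<approx> X F * h E ^ (d - r F)"
    using Var_h_power_top[OF Suc.prems(1) GP] eq Gf by (simp add: X_def)
  finally show ?case .
qed

text \<open>Base case of the induction, in which every factor is E and the test element is the
  complementary power of \<open>h E\<close>. More than a factors bring the total to
  \<open>r E - r F\<close>, where \<open>hm_vanish\<close> applies. The rank bound follows from
  \<open>r G \<le> d + 1\<close>.\<close>

lemma dual_test_element_top:
  assumes F: "flat F" "F \<noteq> E" and "nested F (replicate_mset a E)"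
  defines "T \<equiv> h E ^ (d - r F - a)" and "M \<equiv> replicate_mset a E"
  shows "X F * hm M * T \<approx> X F * h E ^ (d - r F)"
    and "\<And>N. (\<And>G. G \<in># N \<Longrightarrow> G \<in> NF \<and> \<not> G \<subseteq> F) \<Longrightarrow> size M < size N \<Longrightarrow> X F * hm N * T \<in> Z"
    and "\<And>N. (\<And>G. G \<in># N \<Longrightarrow> G \<in> NF \<and> \<not> G \<subseteq> F) \<Longrightarrow> size N \<le> size M \<Longrightarrow>
      rank_sum N + (size M - size N) * r F \<le> rank_sum M \<and>
      (rank_sum N + (size M - size N) * r F = rank_sum M \<longrightarrow> N = M)"
proof -
  have FE: "F \<subset> E" using F flat_subset by auto
  have rF: "r F \<le> d" using flat_rank_less[of F E] FE F rank_E by auto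
  have a: "a \<le> d - r F"
  proof (cases "a = 0")
    case False
    then have "a + r F < d + 1" using nestedD[OF assms(3), of E] rank_E by auto
    then show ?thesis by simp
  qed simp
  show "X F * hm M * T \<approx> X F * h E ^ (d - r F)"
  proof -
    have "a + (d - r F - a) = d - r F" using a by simp
    then show ?thesis by (simp only: T_def M_def hm_replicate mult.assoc power_add[symmetric] eqZ_refl)
  qed
  show "X F * hm N * T \<in> Z"
    if N: "\<And>G. G \<in># N \<Longrightarrow> G \<in> NF \<and> \<not> G \<subseteq> F" "size M < size N" for N
  proof -
    have "X F * hm (N + replicate_mset (d - r F - a) E) \<in> Z"
    proof (rule hm_vanish[of F E])
      show "N + replicate_mset (d - r F - a) E \<noteq> {#}" using N(2) by auto
      show "G \<in> NF \<and> G \<subseteq> E \<and> \<not> G \<subseteq> F" if "G \<in># N + replicate_mset (d - r F - a) E" for G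
        using that N(1)[of G] E_NF FE NF_subset_E[of G] by (auto split: if_splits)
      show "r (F \<union> E) \<le> r F + size (N + replicate_mset (d - r F - a) E)"
        using FE a rF N(2) rank_E by (simp add: sup.absorb2 M_def)
    qed (use F flat_E in auto)
    then show ?thesis by (simp add: T_def mult.assoc)
  qed
  show "rank_sum N + (size M - size N) * r F \<le> rank_sum M \<and>
      (rank_sum N + (size M - size N) * r F = rank_sum M \<longrightarrow> N = M)"
    if N: "\<And>G. G \<in># N \<Longrightarrow> G \<in> NF \<and> \<not> G \<subseteq> F" "size N \<le> size M" for N
  proof -
    have b: "rank_sum N \<le> size N * (d + 1)"
      "rank_sum N = size N * (d + 1) \<Longrightarrow> N = replicate_mset (size N) E"
      using rank_sum_bound[of E N] N NF_subset_E rank_E by auto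
    obtain k where k: "a = size N + k" using N(2) le_Suc_ex by (auto simp: M_def)
    have le: "k * r F \<le> k * d" using rF by simp
    have "rank_sum N + k * r F \<le> (size N + k) * (d + 1)"
      using b(1) le unfolding add_mult_distrib add_mult_distrib2 by linarith
    moreover have "N = M" if eq: "rank_sum N + k * r F = (size N + k) * (d + 1)"
    proof -
      have "k = 0" using eq b(1) le unfolding add_mult_distrib add_mult_distrib2 by linarith
      then show ?thesis using b(2) eq k by (simp add: M_def)
    qed
    ultimately show ?thesis using k rank_E by (simp add: M_def add.commute)
  qed
qed

lemma mset_split_min:
  assumes "chain_mset M" "M \<noteq> replicate_mset (size M) E" "\<And>G. G \<in># M \<Longrightarrow> G \<subseteq> E"
  obtains G where "G \<in># M" "G \<noteq> E" "\<And>H. H \<in># M \<Longrightarrow> G \<subseteq> H"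
    "M = replicate_mset (count M G) G + {#H \<in># M. G \<subset> H#}"
proof -
  obtain G0 where G0: "G0 \<in># M" "G0 \<noteq> E"
    using assms(2) by (metis set_mset_subset_singletonD subsetI singletonI)
  then have "M \<noteq> {#}" by auto
  then obtain G M' where G: "M = add_mset G M'" "\<forall>H\<in>#M'. G \<subseteq> H"
    using chain_mset_min[OF assms(1)] by blast
  have le: "G \<subseteq> H" if "H \<in># M" for H using that G by auto
  have "G \<noteq> E" using le[OF G0(1)] G0 assms(3) by blast
  moreover have "{#H \<in># M. H \<noteq> G#} = {#H \<in># M. G \<subset> H#}"
    using le by (intro filter_mset_cong) auto
  ultimately show ?thesis
    using that[of G] G le mset_split_replicate[of M G] by auto
qed

text \<open>The test elements make the pairing triangular: among the products of \<open>h\<close> that pair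
  non-trivially with the test element of \<open>M\<close>, only \<open>M\<close> itself attains the largest rank sum.
  Missing factors are counted with rank \<open>r F\<close> so that the bound survives the induction.\<close>

definition dual_test :: "nat set \<Rightarrow> nat set multiset \<Rightarrow> poly \<Rightarrow> bool" where
  "dual_test F M T \<longleftrightarrow> X F * hm M * T \<approx> X F * h E ^ (d - r F) \<and>
    (\<forall>N. (\<forall>G. G \<in># N \<longrightarrow> G \<in> NF \<and> \<not> G \<subseteq> F) \<longrightarrow> size M < size N \<longrightarrow> X F * hm N * T \<in> Z) \<and>
    (\<forall>N. (\<forall>G. G \<in># N \<longrightarrow> G \<in> NF \<and> \<not> G \<subseteq> F) \<longrightarrow> size N \<le> size M \<longrightarrow> X F * hm N * T \<notin> Z \<longrightarrow>
      rank_sum N + (size M - size N) * r F \<le> rank_sum M \<and>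
      (rank_sum N + (size M - size N) * r F = rank_sum M \<longrightarrow> N = M))"

text \<open>Let G be the smallest member of M and split a competitor N into the part N1 inside G and
  the part N2 not inside G. If N1 has more than a factors, it vanishes together with the powers of
  G. Otherwise N2 has to survive the test element for the part of M above G, and the two rank bounds
  add up.\<close>

lemma dual_test_exists:
  assumes "flat F" "F \<noteq> E" "nested F M"
  shows "\<exists>T. dual_test F M T"
  using assms
proof (induction "size M" arbitrary: F M rule: less_induct)
  case less
  show ?case
  proof (cases "M = replicate_mset (size M) E")
    case True
    then obtain a where M: "M = replicate_mset a E" by blast
    note * = dual_test_element_top[OF less.prems(1,2) less.prems(3)[unfolded M], folded M]
    have "dual_test F M (h E ^ (d - r F - a))"
      unfolding dual_test_def
    proof (intro conjI[OF *(1)] conjI allI impI)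
      fix N assume N: "\<forall>G. G \<in># N \<longrightarrow> G \<in> NF \<and> \<not> G \<subseteq> F"
      show "X F * hm N * h E ^ (d - r F - a) \<in> Z" if "size M < size N"
        using N that by (intro *(2)) auto
      show "rank_sum N + (size M - size N) * r F \<le> rank_sum M" if "size N \<le> size M"
        using N that *(3)[of N] by auto
      show "N = M" if "size N \<le> size M" "rank_sum N + (size M - size N) * r F = rank_sum M"
        using N that *(3)[of N] by auto
    qed
    then show ?thesis by blast
  next
    case False
    have chM: "chain_mset M" and M_NF: "\<And>G. G \<in># M \<Longrightarrow> G \<in> NF \<and> F \<subset> G"
      using less.prems(3) by (auto simp: nested_def)
    obtain G where G: "G \<in># M" "G \<noteq> E" and min: "\<And>H. H \<in># M \<Longrightarrow> G \<subseteq> H"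
      and split: "M = replicate_mset (count M G) G + {#H \<in># M. G \<subset> H#}"
      using mset_split_min[OF chM False] M_NF NF_subset_E by metis
    define a where "a = count M G"
    define M1 where "M1 = {#H \<in># M. G \<subset> H#}"
    have M: "M = replicate_mset a G + M1" using split by (simp add: a_def M1_def)
    have a0: "a > 0" using G by (simp add: a_def)
    have GP: "G \<in> PF" "F \<subset> G" "G \<in> NF" using G M_NF by (auto simp: NF_def)
    have Gf: "flat G" "G \<noteq> {}" "G \<subseteq> E" using GP PF_subset_E by (auto simp: PF_iff)
    have rk: "r F < r G" using flat_rank_less less.prems(1) GP Gf by auto
    have aG: "a + r F < r G"
      unfolding a_def using min G(1) by (intro nestedD[OF less.prems(3)]) auto
    \<comment> \<open>Chosen such that \<open>a + s\<close> factors inside G are one short of the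
      gap \<open>r G - r F\<close>: any further factor inside G gives zero.\<close>
    define s where "s = r G - r F - 1 - a"
    have s: "a + s = r G - r F - 1" "r G = r F + a + s + 1" using aG by (auto simp: s_def)
    have nested1: "nested G M1"
      unfolding nested_def
    proof (intro conjI ballI)
      show "chain_mset M1" using chM by (auto simp: chain_mset_def is_chain_def M1_def)
      fix H assume H: "H \<in># M1"
      then have HM: "H \<in># M" "G \<subset> H" by (auto simp: M1_def)
      then show "H \<in> NF" "G \<subset> H" using M_NF by auto
      \<comment> \<open>G now plays the role that F had, so the rank gaps of the remaining members
        are unchanged.\<close>
      have "{H' \<in> set_mset M. H' \<subset> H} = insert G {H' \<in> set_mset M1. H' \<subset> H}"
        using min G(1) HM by (auto simp: M1_def)
      then have "G \<union> \<Union>{H' \<in> set_mset M1. H' \<subset> H} = F \<union> \<Union>{H' \<in> set_mset M. H' \<subset> H}"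
        using GP(2) by (simp only: Union_insert) blast
      moreover have "count M1 H = count M H" using HM by (simp add: M1_def)
      ultimately show "count M1 H + r (G \<union> \<Union>{H' \<in> set_mset M1. H' \<subset> H}) < r H"
        using less.prems(3) HM by (auto simp: nested_def)
    qed
    have "size M1 < size M" using M a0 by simp
    from less.hyps[OF this Gf(1) G(2) nested1] obtain T1 where dual: "dual_test G M1 T1" by blast
    have T1: "X G * hm M1 * T1 \<approx> X G * h E ^ (d - r G)"
      using dual unfolding dual_test_def by (rule conjunct1)
    have T1_large: "X G * hm N * T1 \<in> Z"
      if "\<And>L. L \<in># N \<Longrightarrow> L \<in> NF \<and> \<not> L \<subseteq> G" "size M1 < size N" for N
      using dual that unfolding dual_test_def by simp
    have T1_small: "rank_sum N + (size M1 - size N) * r G \<le> rank_sum M1"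
        "rank_sum N + (size M1 - size N) * r G = rank_sum M1 \<Longrightarrow> N = M1"
      if "\<And>L. L \<in># N \<Longrightarrow> L \<in> NF \<and> \<not> L \<subseteq> G" "size N \<le> size M1" "X G * hm N * T1 \<notin> Z" for N
      using dual that unfolding dual_test_def by simp_all
    define T where "T = h G ^ s * (X G * T1)"
    have T: "X F * hm M * T \<approx> X F * h E ^ (d - r F)"
    proof -
      have "X F * hm M * T = X F * h G ^ (a + s) * (X G * hm M1 * T1)"
        by (simp add: T_def M power_add mult_ac)
      also have "\<dots> \<approx> X F * h G ^ (a + s) * (X G * h E ^ (d - r G))" by (rule eqZ_mult[OF T1])
      also have "\<dots> = X F * h G ^ (r G - r F - 1) * (Var G * h E ^ (d - r G))"
        using s(1) Gf by (simp add: X_def)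
      also have "\<dots> \<approx> X F * h E ^ (d - r F)" by (rule Var_h_power_top[OF less.prems(1) GP(1,2)])
      finally show ?thesis .
    qed
    have main: "(size M < size N \<longrightarrow> X F * hm N * T \<in> Z) \<and>
      (size N \<le> size M \<longrightarrow> X F * hm N * T \<notin> Z \<longrightarrow>
        rank_sum N + (size M - size N) * r F \<le> rank_sum M \<and>
        (rank_sum N + (size M - size N) * r F = rank_sum M \<longrightarrow> N = M))"
      if N: "\<And>L. L \<in># N \<Longrightarrow> L \<in> NF \<and> \<not> L \<subseteq> F" for N
    proof -
      define N1 where "N1 = {#L \<in># N. L \<subseteq> G#}"
      define N2 where "N2 = {#L \<in># N. \<not> L \<subseteq> G#}"
      have N_split: "N = N1 + N2" unfolding N1_def N2_def by (rule multiset_partition)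
      have N1: "\<And>L. L \<in># N1 \<Longrightarrow> L \<in> NF \<and> L \<subseteq> G \<and> \<not> L \<subseteq> F"
        and N2: "\<And>L. L \<in># N2 \<Longrightarrow> L \<in> NF \<and> \<not> L \<subseteq> G"
        using N by (auto simp: N1_def N2_def)
      \<comment> \<open>The first grouping shows vanishing caused by factors inside G, the second
        vanishing inherited from \<open>T1\<close>.\<close>
      have prod1: "X F * hm N * T = (X F * hm (N1 + replicate_mset s G)) * (hm N2 * (X G * T1))"
        and prod2: "X F * hm N * T = (X F * hm N1 * h G ^ s) * (X G * hm N2 * T1)"
        by (simp_all add: T_def N_split mult_ac)
      have zero1: "X F * hm N * T \<in> Z" if "a < size N1"
        unfolding prod1
      proof (rule Z_mult_right, rule hm_vanish[of F G])
        show "L \<in> NF \<and> L \<subseteq> G \<and> \<not> L \<subseteq> F" if "L \<in># N1 + replicate_mset s G" for L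
          using that N1[of L] GP by (auto split: if_splits)
        show "r (F \<union> G) \<le> r F + size (N1 + replicate_mset s G)"
          using GP(2) s(2) that by (simp add: sup.absorb2)
      qed (use that less.prems Gf in auto)
      have zero2: "X F * hm N * T \<in> Z" if "X G * hm N2 * T1 \<in> Z"
        unfolding prod2 using that by (rule Z_mult)
      have zero3: "X F * hm N * T \<in> Z" if "size M1 < size N2"
        using that T1_large N2 zero2 by blast
      have "X F * hm N * T \<in> Z" if "size M < size N"
      proof (cases "size M1 < size N2")
        case False
        then have "a < size N1" using that by (simp add: M N_split)
        then show ?thesis by (rule zero1)
      qed (rule zero3)
      moreover have "rank_sum N + (size M - size N) * r F \<le> rank_sum M \<and>
        (rank_sum N + (size M - size N) * r F = rank_sum M \<longrightarrow> N = M)"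
        if sz: "size N \<le> size M" and nz: "X F * hm N * T \<notin> Z"
      proof -
        have sz2: "size N2 \<le> size M1" using zero3 nz by force
        then have b2: "rank_sum N2 + (size M1 - size N2) * r G \<le> rank_sum M1"
          "rank_sum N2 + (size M1 - size N2) * r G = rank_sum M1 \<Longrightarrow> N2 = M1"
          using T1_small[of N2] N2 zero2 nz by blast+
        have b1: "rank_sum N1 \<le> size N1 * r G" "rank_sum N1 = size N1 * r G \<Longrightarrow> N1 = replicate_mset (size N1) G"
          using rank_sum_bound[of G N1] N1 Gf by auto
        \<comment> \<open>k and j count the factors that N lacks against M and N2 against M1. The
          bound for N2 charges \<open>r G\<close> per missing factor, whereas the goal charges only
          \<open>r F\<close>. By \<open>k + size N1 = a + j\<close> the losses balance, and equality
          forces \<open>k = 0\<close>.\<close>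
        define k j where "k = size M - size N" and "j = size M1 - size N2"
        have "k + size N1 = a + j"
          using sz sz2 by (simp add: k_def j_def M N_split)
        then have lin: "k * r G + size N1 * r G = a * r G + j * r G"
          by (metis add_mult_distrib)
        have le: "k * r F \<le> k * r G" using rk by simp
        have "rank_sum N + k * r F \<le> rank_sum M"
          using b1(1) b2(1) le lin
          unfolding M N_split rank_sum_simps j_def[symmetric] by linarith
        moreover have "N = M" if eq: "rank_sum N + k * r F = rank_sum M"
        proof -
          have eqs: "k * r F = k * r G" "rank_sum N1 = size N1 * r G" "rank_sum N2 + j * r G = rank_sum M1"
            using b1(1) b2(1) le lin eq
            unfolding M N_split rank_sum_simps j_def[symmetric] by linarith+
          then have "N2 = M1" "N1 = replicate_mset (size N1) G" "k = 0"
            using b1(2) b2(2) rk by (simp_all add: j_def[symmetric])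
          moreover from this have "size N1 = a"
            using \<open>k + size N1 = a + j\<close> by (simp add: j_def)
          ultimately show ?thesis by (simp add: M N_split)
        qed
        ultimately show ?thesis by (simp add: k_def)
      qed
      ultimately show ?thesis by blast
    qed
    have "dual_test F M T" unfolding dual_test_def using T main by blast
    then show ?thesis by blast
  qed
qed

section \<open>The degree map and Poincare duality\<close>

definition msum :: "(nat set \<Rightarrow>\<^sub>0 nat) \<Rightarrow> nat set set \<Rightarrow> nat" where
  "msum m S = (\<Sum>F\<in>S. lkp m F)"

text \<open>The dragon Hall-Rado condition of Backman, Eur and Simpson, for exponent vectors of
  monomials in the \<open>h F\<close>, which are represented by fresh variables \<open>Var F\<close>.\<close>

definition dragon :: "(nat set \<Rightarrow>\<^sub>0 nat) \<Rightarrow> bool" where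
  "dragon m \<longleftrightarrow> (\<forall>S. S \<subseteq> NF \<longrightarrow> S \<noteq> {} \<longrightarrow> msum m S < r (\<Union>S))"

lemma dragonD: "dragon m \<Longrightarrow> S \<subseteq> NF \<Longrightarrow> S \<noteq> {} \<Longrightarrow> msum m S < r (\<Union>S)"
  by (simp add: dragon_def)

definition bump :: "(nat set \<Rightarrow>\<^sub>0 nat) \<Rightarrow> nat set \<Rightarrow> (nat set \<Rightarrow>\<^sub>0 nat)" where
  "bump m F = m + sgl F 1"

lemma msum_bump: "finite S \<Longrightarrow> msum (bump m F) S = msum m S + of_bool (F \<in> S)"
  by (auto simp: bump_def msum_def lookup_add lookup_single sum.distrib when_def)

lemma msum_mono: "finite T \<Longrightarrow> S \<subseteq> T \<Longrightarrow> msum m S \<le> msum m T"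
  unfolding msum_def by (rule sum_mono2) auto

lemma msum_Un_Int: "finite S \<Longrightarrow> finite T \<Longrightarrow> msum m (S \<union> T) + msum m (S \<inter> T) = msum m S + msum m T"
  unfolding msum_def by (rule sum.union_inter)

lemma finite_sub_NF: "S \<subseteq> NF \<Longrightarrow> finite S"
  using finite_subset finite_NF by blast

lemma Union_sub_NF: "S \<subseteq> NF \<Longrightarrow> \<Union>S \<subseteq> E"
  using NF_subset_E by blast

text \<open>This is the compatibility of the dragon condition with \<open>h_quadratic\<close>.\<close>

lemma dragon_exchange:
  assumes F: "F \<in> NF" and G: "G \<in> NF" and inc: "\<not> F \<subseteq> G" "\<not> G \<subseteq> F"
  defines "K \<equiv> cl (F \<union> G)"
  shows "of_bool (dragon (bump (bump m F) G)) + of_bool (dragon (bump (bump m K) K)) =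
    (of_bool (dragon (bump (bump m F) K)) + of_bool (dragon (bump (bump m G) K)) :: real)"
proof -
  have FG: "F \<union> G \<subseteq> E" using F G NF_subset_E by blast
  have fl: "flat F" "flat G" using F G by (auto simp: NF_iff)
  note K = cl_Un_greater[OF fl inc, folded K_def]
  have KNF: "K \<in> NF" using K by (auto simp: NF_iff)
  have ne: "F \<noteq> K" "G \<noteq> K" "F \<noteq> G" using K inc by auto
  have rK: "r K = r (F \<union> G)" using rank_cl[OF FG] by (simp add: K_def)
  \<comment> \<open>K is the closure of \<open>F \<union> G\<close>, so adding it to a set that
    contains both leaves the rank unchanged.\<close>
  have join: "r (Y \<union> K) = r Y" if "Y \<subseteq> E" "F \<subseteq> Y" "G \<subseteq> Y" for Y
  proof -
    have "r (Y \<union> K) + r (Y \<inter> K) \<le> r Y + r K"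
      using that flat_subset[OF K(1)] by (intro rank_submod)
    moreover have "r K \<le> r (Y \<inter> K)"
      unfolding rK using that K(2,3) by (intro rank_mono) auto
    moreover have "r Y \<le> r (Y \<union> K)" using that flat_subset[OF K(1)] by (intro rank_mono) auto
    ultimately show ?thesis by simp
  qed
  have ms: "msum (bump (bump m A) B) S = msum m S + of_bool (A \<in> S) + of_bool (B \<in> S)"
    if "S \<subseteq> NF" for A B S
    using finite_sub_NF[OF that] by (simp add: msum_bump)
  \<comment> \<open>Four implications yield the identity: (F,G) implies (F,K) and (G,K), each of
    these implies (K,K), both together imply (F,G), and (K,K) implies at least one of them. Hence
    the two sides are both 2, both 1 or both 0.\<close>
  let ?D = "\<lambda>A B. dragon (bump (bump m A) B)"
  have lower: "?D K K" if A: "A \<in> NF" "A \<subset> K" and D: "?D A K" for A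
    unfolding dragon_def
  proof (intro allI impI)
    fix S assume S: "S \<subseteq> NF" "S \<noteq> {}"
    show "msum (bump (bump m K) K) S < r (\<Union>S)"
    proof (cases "K \<in> S")
      case True
      then have U: "\<Union>(insert A S) = \<Union>S" using A by auto
      have "msum m S \<le> msum m (insert A S)" using finite_sub_NF[OF S(1)] by (intro msum_mono) auto
      moreover have "msum (bump (bump m A) K) (insert A S) < r (\<Union>(insert A S))"
        using D S A by (intro dragonD) auto
      ultimately show ?thesis using True S A U by (simp add: ms)
    next
      case False
      then show ?thesis using dragonD[OF D S] S by (simp add: ms)
    qed
  qed
  have raise: "?D A K" if A: "A \<in> {F, G}" and D: "?D F G" for A
    unfolding dragon_def
  proof (intro allI impI)
    fix S assume S: "S \<subseteq> NF" "S \<noteq> {}"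
    show "msum (bump (bump m A) K) S < r (\<Union>S)"
    proof (cases "K \<in> S")
      case True
      let ?S = "insert F (insert G S)"
      have U: "\<Union>?S = \<Union>S" using K True by auto
      have "msum m S \<le> msum m ?S" using finite_sub_NF[OF S(1)] by (intro msum_mono) auto
      moreover have "msum (bump (bump m F) G) ?S < r (\<Union>?S)"
        using D S F G by (intro dragonD) auto
      ultimately show ?thesis using True S F G U by (simp add: ms)
    next
      case False
      then show ?thesis using dragonD[OF D S] S A by (auto simp: ms)
    qed
  qed
  have both: "?D F G" if "?D F K" "?D G K"
    unfolding dragon_def
  proof (intro allI impI)
    fix S assume S: "S \<subseteq> NF" "S \<noteq> {}"
    show "msum (bump (bump m F) G) S < r (\<Union>S)"
    proof (cases "F \<in> S \<and> G \<in> S")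
      case True
      have "\<Union>S \<union> K = \<Union>(insert K S)" by auto
      then have U: "r (\<Union>(insert K S)) = r (\<Union>S)"
        using join[of "\<Union>S"] Union_sub_NF[OF S(1)] True by auto
      have "msum m S \<le> msum m (insert K S)" using finite_sub_NF[OF S(1)] by (intro msum_mono) auto
      moreover have "msum (bump (bump m F) K) (insert K S) < r (\<Union>(insert K S))"
        using that(1) S KNF by (intro dragonD) auto
      ultimately show ?thesis using True S KNF U by (simp add: ms)
    next
      case False
      then show ?thesis using dragonD[OF that(1) S] dragonD[OF that(2) S] S by (auto simp: ms)
    qed
  qed
  have either: "?D F K \<or> ?D G K" if D: "?D K K"
  proof (rule ccontr)
    assume "\<not> ?thesis"
    then obtain S T where S: "S \<subseteq> NF" "S \<noteq> {}" "r (\<Union>S) \<le> msum (bump (bump m F) K) S"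
      and T: "T \<subseteq> NF" "T \<noteq> {}" "r (\<Union>T) \<le> msum (bump (bump m G) K) T"
      by (auto simp: dragon_def not_less)
    \<comment> \<open>S violates the condition for (F,K) but not for (K,K). This forces
      \<open>F \<in> S\<close>, \<open>K \<notin> S\<close> and a rank of at most
      \<open>msum m S + 1\<close>; T is similar with G. Uncrossing gives the contradiction: for
      (K,K), the union exceeds its sum by at least 3 and a nonempty intersection by at least 1,
      while submodularity allows 2 in all.\<close>
    note DS = dragonD[OF D S(1,2)] and DT = dragonD[OF D T(1,2)]
    have inS: "F \<in> S" "K \<notin> S" "r (\<Union>S) \<le> msum m S + 1"
      using S DS by (auto simp: ms of_bool_def split: if_splits)
    have inT: "G \<in> T" "K \<notin> T" "r (\<Union>T) \<le> msum m T + 1"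
      using T DT by (auto simp: ms of_bool_def split: if_splits)
    let ?U = "insert K (S \<union> T)"
    have fin: "finite S" "finite T" using S T finite_sub_NF by auto
    have UE: "\<Union>S \<subseteq> E" "\<Union>T \<subseteq> E" using S T Union_sub_NF by auto
    have "\<Union>?U = (\<Union>S \<union> \<Union>T) \<union> K" by auto
    then have rU: "r (\<Union>?U) = r (\<Union>S \<union> \<Union>T)"
      using join[of "\<Union>S \<union> \<Union>T"] UE inS(1) inT(1) by auto
    have sub: "r (\<Union>S \<union> \<Union>T) + r (\<Union>S \<inter> \<Union>T) \<le> r (\<Union>S) + r (\<Union>T)"
      using UE by (rule rank_submod)
    have "msum (bump (bump m K) K) ?U < r (\<Union>?U)"
      using D S T KNF by (intro dragonD) auto
    moreover have "msum m (S \<union> T) \<le> msum m ?U" using fin by (intro msum_mono) auto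
    ultimately have up: "msum m (S \<union> T) + 2 < r (\<Union>S \<union> \<Union>T)"
      using S T KNF rU by (simp add: ms)
    show False
    proof (cases "S \<inter> T = {}")
      case True
      then have "msum m (S \<union> T) = msum m S + msum m T"
        using msum_Un_Int[OF fin, of m] by (simp add: msum_def)
      then show ?thesis using sub up inS(3) inT(3) by simp
    next
      case False
      have "msum (bump (bump m K) K) (S \<inter> T) < r (\<Union>(S \<inter> T))"
        using D S False by (intro dragonD) auto
      moreover have "r (\<Union>(S \<inter> T)) \<le> r (\<Union>S \<inter> \<Union>T)" using UE by (intro rank_mono) auto
      moreover have "S \<inter> T \<subseteq> NF" using S by auto
      ultimately have "msum m (S \<inter> T) < r (\<Union>S \<inter> \<Union>T)" by (simp add: ms)
      then show ?thesis using msum_Un_Int[OF fin, of m] sub up inS(3) inT(3) by simp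
    qed
  qed
  show ?thesis
  proof (cases "?D F G")
    case True
    then have "?D F K" "?D G K" using raise[of F] raise[of G] by simp_all
    moreover from this have "?D K K" using lower[OF F K(2)] by simp
    ultimately show ?thesis using True by simp
  next
    case False
    show ?thesis
    proof (cases "?D K K")
      case True
      then have "?D F K \<longleftrightarrow> \<not> ?D G K" using either both False by metis
      then show ?thesis using True False by simp
    next
      case f: False
      then have "\<not> ?D F K" "\<not> ?D G K" using lower[OF F K(2)] lower[OF G K(3)] by metis+
      then show ?thesis using f False by simp
    qed
  qed
qed

section \<open>The degree functional on the free ring of simplicial generators\<close>

definition deg_h :: "poly \<Rightarrow> real" where
  "deg_h = lin_ext (\<lambda>m. of_bool (tdeg m = d \<and> dragon m))"

text \<open>The largest ideal inside the kernel of \<open>deg_h\<close>. Placing the Chow generators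
  in it is enough for the degree to descend to the Chow ring.\<close>

definition J :: "poly set" where
  "J = {p. \<forall>q. deg_h (p * q) = 0}"

lemma deg_h_add: "deg_h (p + q) = deg_h p + deg_h q"
  by (simp add: deg_h_def lin_ext_add)

lemma deg_h_Const: "deg_h (Const c * p) = c * deg_h p"
  by (simp add: deg_h_def lin_ext_Const)

lemma deg_h_0 [simp]: "deg_h 0 = 0"
  using deg_h_add[of 0 0] by simp

lemma J_0 [simp]: "0 \<in> J"
  by (simp add: J_def)

lemma J_add: "p \<in> J \<Longrightarrow> q \<in> J \<Longrightarrow> p + q \<in> J"
  by (simp add: J_def ring_distribs deg_h_add)

lemma J_mult: "p \<in> J \<Longrightarrow> q * p \<in> J"
  unfolding J_def by (auto simp: mult.assoc mult.left_commute[of q])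

lemma J_uminus: "p \<in> J \<Longrightarrow> - p \<in> J"
  using J_mult[of p "- 1"] by simp

lemma J_diff: "p \<in> J \<Longrightarrow> q \<in> J \<Longrightarrow> p - q \<in> J"
  using J_add[of p "- q"] J_uminus[of q] by simp

lemma J_sum: "(\<And>a. a \<in> A \<Longrightarrow> g a \<in> J) \<Longrightarrow> sum g A \<in> J"
  by (induction A rule: infinite_finite_induct) (auto simp: J_add)

lemma J_power: "p - q \<in> J \<Longrightarrow> p ^ k - q ^ k \<in> J"
proof (induction k)
  case (Suc k)
  have "p ^ Suc k - q ^ Suc k = p * (p ^ k - q ^ k) + q ^ k * (p - q)"
    by (simp add: algebra_simps)
  then show ?case using Suc by (simp add: J_add J_mult)
qed simp

lemma J_I:
  assumes "\<And>m. deg_h (p * sgl m 1) = 0"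
  shows "p \<in> J"
proof -
  have "deg_h (p * q) = 0" for q
  proof (induction q rule: poly_mapping_add_induct)
    case (single m c)
    have "p * sgl m c = Const c * (p * sgl m 1)"
      by (simp add: single_eq_Const_mult[of m c] mult_ac)
    then show ?case using assms by (simp add: deg_h_Const)
  qed (simp add: ring_distribs deg_h_add)
  then show ?thesis by (simp add: J_def)
qed

text \<open>The singleton \<open>S = {cl {i}}\<close> has a union of rank at most 1, so the dragon
  condition excludes every monomial containing this variable. This mirrors
  \<open>h (cl {i}) \<approx> 0\<close>.\<close>

lemma J_atom:
  assumes "i \<in> E"
  shows "Var (cl {i}) \<in> J"
proof (rule J_I)
  fix m
  let ?K = "cl {i}"
  have i: "{i} \<subseteq> E" using assms by simp
  have "?K \<in> NF" using flat_cl[OF i] subset_cl[OF i] by (auto simp: NF_iff)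
  moreover have "r ?K \<le> 1"
  proof -
    have "r {i} \<le> card {i}" using matroid i unfolding matroid_rank_def by blast
    then show ?thesis using rank_cl[OF i] by simp
  qed
  moreover have "msum (bump m ?K) {?K} \<ge> 1" by (simp add: msum_bump)
  ultimately have "\<not> dragon (bump m ?K)"
    using dragonD[of "bump m ?K" "{?K}"] by auto
  then show "deg_h (Var ?K * sgl m 1) = 0"
    by (simp add: Var_def mult_single deg_h_def lin_ext_single bump_def add.commute)
qed

lemma deg_h_Var_Var_single:
  "deg_h (Var A * Var B * sgl m 1) = of_bool (tdeg m + 2 = d) * of_bool (dragon (bump (bump m A) B))"
  by (simp add: Var_def mult_single deg_h_def lin_ext_single tdeg_add bump_def add_ac)

lemma J_quadratic:
  assumes "F \<in> NF" "G \<in> NF" "\<not> F \<subseteq> G" "\<not> G \<subseteq> F"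
  defines "K \<equiv> cl (F \<union> G)"
  shows "(Var F - Var K) * (Var G - Var K) \<in> J"
proof (rule J_I)
  fix m
  have minus: "deg_h (- p) = - deg_h p" for p
    using deg_h_Const[of "- 1" p] by (simp add: Const_uminus)
  have "(Var F - Var K) * (Var G - Var K) * sgl m 1 =
      Var F * Var G * sgl m 1 + Var K * Var K * sgl m 1 + (- (Var F * Var K * sgl m 1)) + (- (Var G * Var K * sgl m 1))"
    by (simp add: algebra_simps)
  then have "deg_h ((Var F - Var K) * (Var G - Var K) * sgl m 1) =
      of_bool (tdeg m + 2 = d) * ((of_bool (dragon (bump (bump m F) G)) + of_bool (dragon (bump (bump m K) K))) -
        (of_bool (dragon (bump (bump m F) K)) + of_bool (dragon (bump (bump m G) K))))"
    by (simp only: deg_h_add minus deg_h_Var_Var_single) (simp add: algebra_simps)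
  then show "deg_h ((Var F - Var K) * (Var G - Var K) * sgl m 1) = 0"
    using dragon_exchange[OF assms(1-4), of m, folded K_def] by simp
qed

text \<open>\<open>xi F\<close> is the Moebius inversion that expresses \<open>x_F\<close> in the variables for the \<open>h F\<close>.\<close>

function xi :: "nat set \<Rightarrow> poly" where
  "xi F = - Var F - (\<Sum>G\<in>{G \<in> NF. F \<subset> G}. xi G)"
  by auto
termination
proof (relation "measure (\<lambda>F. card (E - F))")
  fix F G assume "G \<in> {G \<in> NF. F \<subset> G}"
  then have "E - G \<subset> E - F" using NF_subset_E[of G] by auto
  then show "(G, F) \<in> measure (\<lambda>F. card (E - F))" by (simp add: psubset_card_mono)
qed simp

declare xi.simps [simp del]

lemma xi_sum:
  assumes "F \<in> NF"
  shows "(\<Sum>G\<in>{G \<in> NF. F \<subseteq> G}. xi G) = - Var F"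
proof -
  have "{G \<in> NF. F \<subseteq> G} = insert F {G \<in> NF. F \<subset> G}" using assms by auto
  moreover have "sum xi (insert F {G \<in> NF. F \<subset> G}) = xi F + sum xi {G \<in> NF. F \<subset> G}"
    by simp
  ultimately show ?thesis using xi.simps[of F] by simp
qed

lemma Var_diff_xi:
  assumes "F \<in> NF" "K \<in> NF" "F \<subseteq> K"
  shows "Var F - Var K = - (\<Sum>H\<in>{H \<in> NF. F \<subseteq> H \<and> \<not> K \<subseteq> H}. xi H)"
proof -
  have "(\<Sum>H\<in>{H \<in> NF. F \<subseteq> H}. xi H) =
      (\<Sum>H\<in>{H \<in> NF. K \<subseteq> H}. xi H) + (\<Sum>H\<in>{H \<in> NF. F \<subseteq> H \<and> \<not> K \<subseteq> H}. xi H)"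
    using assms(3) by (subst sum.union_disjoint[symmetric]) (auto intro!: sum.cong)
  then show ?thesis using xi_sum[OF assms(1)] xi_sum[OF assms(2)] by (simp add: algebra_simps)
qed

text \<open>Expanded by \<open>Var_diff_xi\<close>, the quadratic element of J becomes a double sum
  of products of \<open>xi\<close>. One term is \<open>xi F * xi G\<close>. All others belong to
  incomparable pairs with at least one larger flat and are covered by induction.\<close>

lemma xi_incomparable:
  assumes "F \<in> NF" "G \<in> NF" "\<not> F \<subseteq> G" "\<not> G \<subseteq> F"
  shows "xi F * xi G \<in> J"
  using assms
proof (induction "card (E - F) + card (E - G)" arbitrary: F G rule: less_induct)
  case less
  define K where "K = cl (F \<union> G)"
  have fl: "flat F" "flat G" using less.prems by (auto simp: NF_iff)
  note K = cl_Un_greater[OF fl less.prems(3,4), folded K_def]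
  have KNF: "K \<in> NF" using K by (auto simp: NF_iff)
  have FGE: "F \<union> G \<subseteq> E" using less.prems NF_subset_E by blast
  define A where "A = {H \<in> NF. F \<subseteq> H \<and> \<not> K \<subseteq> H}"
  define B where "B = {H \<in> NF. G \<subseteq> H \<and> \<not> K \<subseteq> H}"
  have fin: "finite (A \<times> B)" by (simp add: A_def B_def)
  have FGin: "(F, G) \<in> A \<times> B" using less.prems K by (auto simp: A_def B_def)
  have others: "xi H * xi H' \<in> J" if H: "H \<in> A" "H' \<in> B" "(H, H') \<noteq> (F, G)" for H H'
  proof (rule less.hyps)
    have sub: "F \<subseteq> H" "G \<subseteq> H'" "H \<in> NF" "H' \<in> NF" using H by (auto simp: A_def B_def)
    show "H \<in> NF" "H' \<in> NF" by fact+
    have "K \<subseteq> L" if "L \<in> NF" "F \<subseteq> L" "G \<subseteq> L" for L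
      unfolding K_def using that FGE by (intro cl_minimal) (auto simp: NF_iff)
    then show "\<not> H \<subseteq> H'" "\<not> H' \<subseteq> H" using H by (auto simp: A_def B_def)
    have le: "card (E - H) \<le> card (E - F)" "card (E - H') \<le> card (E - G)"
      using sub by (auto intro!: card_mono)
    have "card (E - H) < card (E - F)" if "H \<noteq> F"
      using sub that NF_subset_E[of H] by (intro psubset_card_mono) auto
    moreover have "card (E - H') < card (E - G)" if "H' \<noteq> G"
      using sub that NF_subset_E[of H'] by (intro psubset_card_mono) auto
    ultimately show "card (E - H) + card (E - H') < card (E - F) + card (E - G)"
      using H(3) le by fastforce
  qed
  have "(Var F - Var K) * (Var G - Var K) = sum xi A * sum xi B"
    using less.prems KNF K by (simp add: Var_diff_xi A_def B_def)
  also have "\<dots> = (\<Sum>(H, H')\<in>A \<times> B. xi H * xi H')"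
    by (simp add: sum_product sum.cartesian_product)
  also have "\<dots> = xi F * xi G + (\<Sum>(H, H')\<in>A \<times> B - {(F, G)}. xi H * xi H')"
    using sum.remove[OF fin FGin, of "\<lambda>(H, H'). xi H * xi H'"] by simp
  finally have "xi F * xi G = (Var F - Var K) * (Var G - Var K) - (\<Sum>(H, H')\<in>A \<times> B - {(F, G)}. xi H * xi H')"
    by simp
  moreover have "(Var F - Var K) * (Var G - Var K) \<in> J"
    using J_quadratic less.prems by (simp add: K_def)
  moreover have "(\<Sum>(H, H')\<in>A \<times> B - {(F, G)}. xi H * xi H') \<in> J"
    using others by (intro J_sum) auto
  ultimately show ?case by (simp add: J_diff)
qed

section \<open>The degree map on the Chow ring\<close>

definition to_h :: "poly \<Rightarrow> poly" where
  "to_h = subst (\<lambda>S. if S \<in> PF then xi S else 0)"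

text \<open>The flats through i are those above \<open>cl {i}\<close>, so the sum telescopes. It
  depends on i only through the variable of an atom, which lies in J; hence the linear generators
  are mapped into J.\<close>

lemma to_h_alpha:
  assumes "i \<in> E"
  shows "to_h (\<Sum>F\<in>{F \<in> PF. i \<in> F}. Var F) = - Var (cl {i}) - xi E"
proof -
  have i: "{i} \<subseteq> E" using assms by simp
  have cl_NF: "cl {i} \<in> NF" using flat_cl[OF i] subset_cl[OF i] by (auto simp: NF_iff)
  have "{F \<in> NF. cl {i} \<subseteq> F} = {F \<in> NF. i \<in> F}"
    using subset_cl[OF i] cl_minimal[OF i] by (auto simp: NF_iff)
  also have "\<dots> = insert E {F \<in> PF. i \<in> F}" using assms by (auto simp: NF_def)
  finally have "sum xi (insert E {F \<in> PF. i \<in> F}) = - Var (cl {i})"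
    using xi_sum[OF cl_NF] by simp
  moreover have "E \<notin> {F \<in> PF. i \<in> F}" by (simp add: PF_iff)
  ultimately have "sum xi {F \<in> PF. i \<in> F} = - Var (cl {i}) - xi E"
    by (simp add: algebra_simps)
  then show ?thesis unfolding to_h_def by (simp add: subst_sum)
qed

lemma to_h_Z:
  assumes "p \<in> Z"
  shows "to_h p \<in> J"
proof -
  have "chow_matroid_ideal E r \<subseteq> {p \<in> polys_in PF. to_h p \<in> J}"
    unfolding chow_matroid_ideal_def
  proof (rule genideal_polys_minimal)
    show "chow_matroid_gens E r \<subseteq> {p \<in> polys_in PF. to_h p \<in> J}"
    proof
      fix p assume p: "p \<in> chow_matroid_gens E r"
      then consider F G where "p = Var F * Var G" "F \<in> PF" "G \<in> PF" "\<not> F \<subseteq> G" "\<not> G \<subseteq> F"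
        | i j where "p = (\<Sum>F\<in>{F \<in> PF. i \<in> F}. Var F) - (\<Sum>F\<in>{F \<in> PF. j \<in> F}. Var F)" "i \<in> E" "j \<in> E"
        unfolding chow_matroid_gens_def by blast
      then have "to_h p \<in> J"
      proof cases
        case 1
        then show ?thesis
          using xi_incomparable[of F G] PF_subset_NF by (simp add: to_h_def subst_mult)
      next
        case 2
        then have "to_h p = Var (cl {j}) - Var (cl {i})"
          using to_h_alpha by (simp add: to_h_def subst_diff)
        then show ?thesis using 2 J_atom by (simp add: J_diff)
      qed
      then show "p \<in> {p \<in> polys_in PF. to_h p \<in> J}" using p chow_matroid_gens_subset by blast
    qed
  qed (simp_all add: to_h_def subst_add subst_mult J_add J_mult polys_in_add polys_in_mult subset_eq)
  then have "to_h (retract p) \<in> J" using assms by (auto simp: Z_def)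
  moreover have "to_h (retract p) = to_h p"
    unfolding to_h_def retract_def subst_subst
    by (rule arg_cong[where f = "\<lambda>f. subst f p"]) auto
  ultimately show ?thesis by simp
qed

definition deg :: "poly \<Rightarrow> real" where
  "deg p = deg_h (to_h p)"

lemma deg_add: "deg (p + q) = deg p + deg q"
  by (simp add: deg_def to_h_def subst_add deg_h_add)

lemma deg_Const: "deg (Const c * p) = c * deg p"
  by (simp add: deg_def to_h_def subst_mult deg_h_Const)

lemma deg_uminus: "deg (- p) = - deg p"
  using deg_Const[of "- 1" p] by (simp add: Const_uminus)

lemma deg_diff: "deg (p - q) = deg p - deg q"
  using deg_add[of p "- q"] by (simp add: deg_uminus)

lemma deg_0 [simp]: "deg 0 = 0"
  using deg_diff[of 0 0] by simp

lemma deg_sum: "deg (sum g A) = (\<Sum>a\<in>A. deg (g a))"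
  by (induction A rule: infinite_finite_induct) (auto simp: deg_add)

lemma deg_Z: "p \<in> Z \<Longrightarrow> deg p = 0"
  using to_h_Z[of p] unfolding J_def deg_def by (metis (mono_tags, lifting) mem_Collect_eq mult.right_neutral)

lemma deg_eqZ: "p \<approx> q \<Longrightarrow> deg p = deg q"
  using deg_Z[of "p - q"] by (simp add: eqZ_def deg_diff)

lemma homog_xi: "xi F \<in> homog 1"
proof (induction F rule: xi.induct)
  case (1 F)
  then show ?case by (subst xi.simps) (auto intro!: homog_diff homog_uminus homog_sum)
qed

lemma deg_homog: "p \<in> homog k \<Longrightarrow> k \<noteq> d \<Longrightarrow> deg p = 0"
proof -
  assume p: "p \<in> homog k" and k: "k \<noteq> d"
  have "to_h p \<in> homog k"
    unfolding to_h_def using homog_xi p by (intro homog_subst) auto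
  then show ?thesis
    using k unfolding deg_def deg_h_def lin_ext_def
    by (intro sum.neutral) (auto simp: homog_iff)
qed

lemma Var_power: "Var S ^ k = sgl (sgl S k) 1"
  by (induction k) (auto simp: Var_def mult_single single_add[symmetric])

lemma deg_top: "deg (h E ^ d) = 1"
proof -
  have 0: "0 \<in> E" by simp
  have "{F \<in> PF. E \<subseteq> F} = {}"
    using PF_subset_E by (auto simp: PF_iff dest: subset_antisym)
  then have hE: "h E = alpha" by (simp only: h_def sum.empty diff_zero)
  have "{G \<in> NF. E \<subset> G} = {}" using NF_subset_E by blast
  then have "xi E = - Var E" by (subst xi.simps) (simp only: sum.empty diff_zero)
  then have "to_h (h E) - Var E = - Var (cl {0})"
    using to_h_alpha[OF 0] unfolding hE alpha_def by simp
  then have "to_h (h E) - Var E \<in> J" using J_atom[OF 0] J_uminus by metis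
  then have "to_h (h E) ^ d - Var E ^ d \<in> J" by (rule J_power)
  then have "deg_h ((to_h (h E) ^ d - Var E ^ d) * 1) = 0" unfolding J_def by blast
  moreover have "deg_h (to_h (h E) ^ d) = deg_h (to_h (h E) ^ d - Var E ^ d) + deg_h (Var E ^ d)"
    by (simp flip: deg_h_add)
  \<comment> \<open>Only families containing E have a positive sum, and their union E has rank
    \<open>d + 1\<close>, just above d.\<close>
  moreover have "dragon (sgl E d)"
    unfolding dragon_def
  proof (intro allI impI)
    fix S assume S: "S \<subseteq> NF" "S \<noteq> {}"
    have pos: "r (\<Union>S) > 0"
      using S Union_sub_NF[OF S(1)] by (intro rank_pos) (auto simp: NF_iff)
    have "msum (sgl E d) S = (if E \<in> S then d else 0)"
      using finite_sub_NF[OF S(1)] by (simp add: msum_def lookup_single when_def)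
    moreover have "\<Union>S = E" if "E \<in> S" using that Union_sub_NF[OF S(1)] by auto
    ultimately show "msum (sgl E d) S < r (\<Union>S)" using pos rank_E by auto
  qed
  then have "deg_h (Var E ^ d) = 1"
    by (simp add: Var_power deg_h_def lin_ext_single)
  ultimately show ?thesis by (simp add: deg_def to_h_def subst_power)
qed

text \<open>All degrees are handled at once, with p and q inhomogeneous: \<open>deg\<close> ignores
  every component of degree other than d.\<close>

theorem poincare_duality: "p \<in> Z \<longleftrightarrow> (\<forall>q. deg (p * q) = 0)"
proof (intro iffI allI)
  show "deg (p * q) = 0" if "p \<in> Z" for q using that by (intro deg_Z Z_mult_right)
next
  assume deg0: "\<forall>q. deg (p * q) = 0"
  obtain A c where A: "finite A" "\<And>M. M \<in> A \<Longrightarrow> nested {} M" "p \<approx> (\<Sum>M\<in>A. Const (c M) * hm M)"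
    using nested_expansion[of p] by (elim exE conjE) (rule that, auto)
  have "c M = 0" if "M \<in> A" for M
  proof (rule ccontr)
    assume "c M \<noteq> 0"
    define A' where "A' = {M \<in> A. c M \<noteq> 0}"
    have "finite A'" "A' \<noteq> {}" using A(1) \<open>M \<in> A\<close> \<open>c M \<noteq> 0\<close> by (auto simp: A'_def)
    \<comment> \<open>A product N that pairs nontrivially with the test element of L either has
      smaller rank sum than L or is L. Minimality of L excludes the first case, so the pairing
      isolates the coefficient of L.\<close>
    then obtain L where L: "L \<in> A'" and min: "\<And>N. N \<in> A' \<Longrightarrow> rank_sum L \<le> rank_sum N"
      using ex_min_if_finite[of "rank_sum ` A'"] by (auto simp: not_less)
    have NFelem: "G \<in> NF \<and> \<not> G \<subseteq> {}" if "N \<in> A" "G \<in># N" for N G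
      using A(2)[OF that(1)] that(2) by (auto simp: nested_def NF_iff)
    have "nested {} L" using L A(2) by (auto simp: A'_def)
    then obtain T where T: "dual_test {} L T"
      using dual_test_exists[OF flat_empty] by auto
    have other: "c N * deg (hm N * T) = 0" if N: "N \<in> A" "N \<noteq> L" for N
    proof (cases "c N = 0")
      case False
      then have "rank_sum L \<le> rank_sum N" using N min by (auto simp: A'_def)
      have "X {} * hm N * T \<in> Z"
      proof (rule ccontr)
        assume nz: "X {} * hm N * T \<notin> Z"
        then have "\<not> size L < size N"
          using T NFelem[OF N(1)] unfolding dual_test_def by blast
        then have "rank_sum N + (size L - size N) * r {} \<le> rank_sum L \<and>
            (rank_sum N + (size L - size N) * r {} = rank_sum L \<longrightarrow> N = L)"
          using T NFelem[OF N(1)] nz unfolding dual_test_def by (simp add: not_less)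
        then show False using N(2) \<open>rank_sum L \<le> rank_sum N\<close> by simp
      qed
      then show ?thesis using deg_Z by (simp add: X_def)
    qed simp
    have "deg (p * T) = deg ((\<Sum>M\<in>A. Const (c M) * hm M) * T)"
      by (intro deg_eqZ eqZ_mult_right A(3))
    also have "\<dots> = (\<Sum>N\<in>A. c N * deg (hm N * T))"
      by (simp add: sum_distrib_right deg_sum mult.assoc deg_Const)
    also have "\<dots> = (\<Sum>N\<in>{L}. c N * deg (hm N * T))"
      using A(1) L other by (intro sum.mono_neutral_right) (auto simp: A'_def)
    finally have "c L * deg (hm L * T) = 0" using deg0 by simp
    moreover have "hm L * T \<approx> h E ^ d" using T by (simp add: dual_test_def X_def)
    then have "deg (hm L * T) = 1" using deg_eqZ deg_top by auto
    ultimately show False using L by (simp add: A'_def)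
  qed
  then have "(\<Sum>M\<in>A. Const (c M) * hm M) = 0" by (intro sum.neutral) simp
  then show "p \<in> Z" using A(3) by (simp add: eqZ_def)
qed

section \<open>Reduction of functionals to chain monomials\<close>

lemma deg_flag:
  assumes "C \<subseteq> PF" "is_chain C" "card C = d"
  shows "deg (mono C) = 1"
proof -
  have "C \<subseteq> {G \<in> PF. {} \<subset> G}" using assms(1) by (auto simp: PF_iff)
  then have "X {} * mono C \<approx> X {} * h E ^ (d - r {})"
    using assms by (intro mono_flag flat_empty) auto
  then show ?thesis using deg_eqZ[of "mono C"] deg_top by (simp add: X_def)
qed

definition xm :: "nat set multiset \<Rightarrow> poly" where
  "xm M = prod_mset (image_mset Var M)"

lemma xm_simps [simp]: "xm {#} = 1" "xm (add_mset G M) = Var G * xm M" "xm (M + N) = xm M * xm N"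
  by (auto simp: xm_def)

lemma xm_mset_set: "xm (mset_set C) = mono C"
  by (simp add: xm_def mono_def prod_unfold_prod_mset)

lemma chain_neighbours:
  assumes "C \<subseteq> PF" "is_chain C" "H \<in> C"
  obtains i j where "i \<in> H" "j \<in> E" "j \<notin> H"
    "\<And>G. G \<in> C \<Longrightarrow> G \<subset> H \<Longrightarrow> i \<notin> G" "\<And>G. G \<in> C \<Longrightarrow> H \<subset> G \<Longrightarrow> j \<in> G"
proof -
  have fin: "finite C" using finite_subset[OF assms(1) finite_PF] .
  have HP: "H \<in> PF" using assms by blast
  then have H: "H \<noteq> {}" "H \<subset> E" using PF_subset_E[OF HP] by (simp_all add: PF_iff psubset_eq)
  have "\<exists>i\<in>H. \<forall>G\<in>C. G \<subset> H \<longrightarrow> i \<notin> G"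
  proof (cases "{G \<in> C. G \<subset> H} = {}")
    case True
    then show ?thesis using H by blast
  next
    case False
    then have "\<Union>{G \<in> C. G \<subset> H} \<in> {G \<in> C. G \<subset> H}"
      using fin assms(2) by (intro Union_chain_in) (auto simp: is_chain_def)
    then have "\<Union>{G \<in> C. G \<subset> H} \<subset> H" by blast
    then show ?thesis by blast
  qed
  moreover have "\<exists>j\<in>E - H. \<forall>G\<in>C. H \<subset> G \<longrightarrow> j \<in> G"
  proof (cases "{G \<in> C. H \<subset> G} = {}")
    case True
    then show ?thesis using H by blast
  next
    case False
    then obtain G0 where "G0 \<in> {G \<in> C. H \<subset> G}" and "\<And>G. G \<in> {G \<in> C. H \<subset> G} \<Longrightarrow> G \<subseteq> G0 \<Longrightarrow> G0 = G"
      using finite_has_minimal[of "{G \<in> C. H \<subset> G}"] fin by (metis (no_types, lifting) finite_subset mem_Collect_eq subsetI)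
    then have G0: "G0 \<in> C" "H \<subset> G0" and min: "\<And>G. G \<in> C \<Longrightarrow> H \<subset> G \<Longrightarrow> G \<subseteq> G0 \<Longrightarrow> G = G0"
      by blast+
    obtain j where j: "j \<in> G0" "j \<notin> H" using G0 by blast
    have "j \<in> E" using j(1) G0(1) assms(1) PF_subset_E by blast
    moreover have "j \<in> G" if "G \<in> C" "H \<subset> G" for G
      using assms(2) that G0(1) min[OF that] j(1) unfolding is_chain_def by blast
    ultimately show ?thesis using j(2) by blast
  qed
  ultimately obtain i j where "i \<in> H" "\<forall>G\<in>C. G \<subset> H \<longrightarrow> i \<notin> G"
    and "j \<in> E - H" "\<forall>G\<in>C. H \<subset> G \<longrightarrow> j \<in> G" by (elim bexE)
  then show ?thesis by (intro that[of i j]) simp_all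
qed

lemma mono_Var_Z:
  assumes "finite C" "G \<in> C" "\<not> F \<subseteq> G" "\<not> G \<subseteq> F"
  shows "mono C * Var F \<in> Z"
proof -
  have "mono C * Var F = mono (C - {G}) * (Var G * Var F)"
    using assms by (simp add: mono_def prod.remove mult_ac)
  then show ?thesis using assms Z_incomparable by (simp add: Z_mult)
qed

text \<open>The linear relation attached to elements \<open>i \<in> H\<close>, \<open>j \<notin> H\<close> that separate \<open>H\<close> from its
  neighbours in the chain trades a repeated factor \<open>H\<close> for larger chains.\<close>

lemma functional_zero_chain:
  fixes L :: "poly \<Rightarrow> real"
  assumes add: "\<And>p q. L (p + q) = L p + L q" and Const: "\<And>c p. L (Const c * p) = c * L p"
    and Z: "\<And>p. p \<in> Z \<Longrightarrow> L p = 0"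
    and chain: "\<And>C. C \<subseteq> PF \<Longrightarrow> is_chain C \<Longrightarrow> L (mono C) = 0"
  assumes "C \<subseteq> PF" "is_chain C" "set_mset M \<subseteq> C"
  shows "L (mono C * xm M) = 0"
  using assms(5-)
proof (induction "size M" arbitrary: C M)
  case 0
  then show ?case using chain by simp
next
  case (Suc k)
  then obtain H M' where M: "M = add_mset H M'" by (metis size_eq_Suc_imp_eq_union)
  then have H: "H \<in> C" "k = size M'" "set_mset M' \<subseteq> C" using Suc by auto
  have fin: "finite C" using finite_subset[OF Suc.prems(1) finite_PF] .
  obtain i j where i: "i \<in> H" "\<And>G. G \<in> C \<Longrightarrow> G \<subset> H \<Longrightarrow> i \<notin> G"
    and j: "j \<in> E" "j \<notin> H" "\<And>G. G \<in> C \<Longrightarrow> H \<subset> G \<Longrightarrow> j \<in> G"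
    using chain_neighbours[OF Suc.prems(1,2) H(1)] by metis
  have HP: "H \<in> PF" using H Suc.prems by blast
  then have iE: "i \<in> E" using PF_subset_E i(1) by blast
  have minus: "L (p - q) = L p - L q" for p q
    using add[of p "Const (- 1) * q"] Const[of "- 1" q] by (simp add: Const_uminus)
  have L0: "L 0 = 0" using Z Z_0 by blast
  have Lsum: "L (sum g A) = (\<Sum>a\<in>A. L (g a))" for g :: "nat set \<Rightarrow> poly" and A
    by (induction A rule: infinite_finite_induct) (auto simp: add L0)
  define g where "g F = L (mono C * Var F * xm M')" for F
  have g0: "g F = 0" if F: "F \<in> PF" "F \<noteq> H" "i \<in> F \<longleftrightarrow> j \<notin> F" for F
  proof (cases "\<forall>G\<in>C. F \<subseteq> G \<or> G \<subseteq> F")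
    case False
    then have "mono C * Var F \<in> Z" using mono_Var_Z[OF fin] by blast
    then show ?thesis unfolding g_def using Z Z_mult_right by blast
  next
    case True
    then have comp: "F \<subseteq> H \<or> H \<subseteq> F" using H(1) by blast
    \<comment> \<open>If F lies below H it misses j, and if it lies above H it contains i; since F
      separates i from j, both hold. Members of C below H miss i and those above H contain j, so F
      is a new member of the chain.\<close>
    then have iF: "i \<in> F" "j \<notin> F" using F(3) i(1) j(2) by blast+
    then have "F \<notin> C" using comp F(2) i(2) j(3) by blast
    then have "mono C * Var F = mono (insert F C)" using fin by (simp add: mono_def mult.commute)
    moreover have "is_chain (insert F C)" using True Suc.prems(2) by (auto simp: is_chain_def)
    ultimately show ?thesis
      unfolding g_def using Suc.hyps(1)[of M' "insert F C"] H Suc.prems(1) F(1) by auto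
  qed
  have "(\<Sum>F\<in>{F \<in> PF. i \<in> F}. Var F) - (\<Sum>F\<in>{F \<in> PF. j \<in> F}. Var F) \<in> Z" (is "?R \<in> Z")
    using iE j(1) by (rule Z_linear)
  then have "L ((mono C * xm M') * ?R) = 0" by (intro Z Z_mult)
  moreover have "(mono C * xm M') * ?R =
    (\<Sum>F\<in>{F \<in> PF. i \<in> F}. mono C * Var F * xm M') - (\<Sum>F\<in>{F \<in> PF. j \<in> F}. mono C * Var F * xm M')"
    by (simp add: right_diff_distrib sum_distrib_left mult_ac)
  ultimately have "(\<Sum>F\<in>{F \<in> PF. i \<in> F}. g F) - (\<Sum>F\<in>{F \<in> PF. j \<in> F}. g F) = 0"
    by (simp add: minus Lsum g_def)
  then have "(\<Sum>F\<in>PF. of_bool (i \<in> F) * g F) - (\<Sum>F\<in>PF. of_bool (j \<in> F) * g F) = 0"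
    by (simp add: of_bool_def if_distrib[of "\<lambda>x. x * _"] sum.inter_filter cong: if_cong)
  then have "(\<Sum>F\<in>PF. (of_bool (i \<in> F) - of_bool (j \<in> F)) * g F) = 0"
    by (simp add: left_diff_distrib sum_subtractf)
  moreover have "(\<Sum>F\<in>PF. (of_bool (i \<in> F) - of_bool (j \<in> F)) * g F) =
      (\<Sum>F\<in>{H}. (of_bool (i \<in> F) - of_bool (j \<in> F)) * g F)"
    using HP g0 by (intro sum.mono_neutral_right) auto
  ultimately have "g H = 0" using i(1) j(2) by simp
  then show ?case unfolding g_def M by (simp add: mult_ac)
qed

text \<open>The dual form of the fact that squarefree chain monomials span the Chow ring, suited to
  comparing two functionals through their difference.\<close>

lemma functional_zero:
  fixes L :: "poly \<Rightarrow> real"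
  assumes add: "\<And>p q. L (p + q) = L p + L q" and Const: "\<And>c p. L (Const c * p) = c * L p"
    and Z: "\<And>p. p \<in> Z \<Longrightarrow> L p = 0"
    and chain: "\<And>C. C \<subseteq> PF \<Longrightarrow> is_chain C \<Longrightarrow> L (mono C) = 0"
  shows "L p = 0"
proof -
  have xm0: "L (xm M) = 0" for M
  proof (cases "set_mset M \<subseteq> PF \<and> is_chain (set_mset M)")
    case True
    \<comment> \<open>One copy of each flat forms the chain, and the surplus copies form the second
      factor of \<open>functional_zero_chain\<close>.\<close>
    have "mset_set (set_mset M) \<subseteq># M" by (simp add: mset_set_set_mset_msubset)
    then obtain N where N: "M = mset_set (set_mset M) + N" by (metis subset_mset.add_diff_inverse)
    then have "set_mset N \<subseteq> set_mset M" by (metis set_mset_union sup_ge2)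
    then have "L (mono (set_mset M) * xm N) = 0"
      using True by (intro functional_zero_chain[of L, OF add Const Z chain]) simp_all
    then show ?thesis by (subst N) (simp add: xm_mset_set)
  next
    case False
    have "xm M \<in> Z"
    proof (cases "set_mset M \<subseteq> PF")
      case True
      then have "\<not> chain_mset M" using False by (simp add: chain_mset_def)
      then obtain F G N where "M = add_mset F (add_mset G N)" "\<not> F \<subseteq> G" "\<not> G \<subseteq> F"
        using not_chain_mset_split by blast
      then show ?thesis using Z_incomparable by (simp add: mult.assoc[symmetric] Z_mult_right)
    next
      case False
      then obtain S N where "M = add_mset S N" "S \<notin> PF" by (metis multi_member_split subsetI)
      then show ?thesis using Z_Var by (simp add: Z_mult_right)
    qed
    then show ?thesis by (rule Z)
  qed
  \<comment> \<open>L is only linear, so the variables split off from p are accumulated in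
    M.\<close>
  have "L (xm M * p) = 0" for M
  proof (induction p arbitrary: M rule: poly_induct)
    case one
    then show ?case using xm0 by simp
  next
    case (Var p S)
    have "xm M * (Var S * p) = xm (add_mset S M) * p" by (simp add: mult_ac)
    then show ?case using Var by metis
  next
    case (Const p c)
    have "xm M * (Const c * p) = Const c * (xm M * p)" by (simp add: mult_ac)
    then show ?case by (simp only: assms(2) Const mult_zero_right)
  next
    case (add p q)
    then show ?case by (simp add: ring_distribs assms(1))
  qed
  from this[of "{#}"] show ?thesis by simp
qed

text \<open>The top degree is one-dimensional: the difference has degree 0, its products with
  nonconstant monomials have degree 0 for reasons of grading, and duality places it in Z.\<close>

lemma top_degree_multiple:
  assumes "p \<in> homog d" "C \<subseteq> PF" "is_chain C" "card C = d"
  shows "p \<approx> Const (deg p) * mono C"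
proof -
  have fin: "finite C" using finite_subset[OF assms(2) finite_PF] .
  let ?s = "p - Const (deg p) * mono C"
  have s: "?s \<in> homog d"
    using assms homog_mono[OF fin] by (intro homog_diff homog_Const_mult) auto
  have deg_s: "deg ?s = 0" using deg_flag[OF assms(2-4)] by (simp add: deg_diff deg_Const)
  have "deg (?s * q) = 0" for q
  proof (induction q rule: poly_mapping_add_induct)
    case (single m c)
    show ?case
    proof (cases "m = 0")
      case True
      then have "?s * sgl m c = Const c * ?s" by (simp add: Const_def)
      then show ?thesis using deg_s by (simp only: deg_Const mult_zero_right)
    next
      case False
      then have "tdeg m \<noteq> 0" by (simp add: tdeg_eq_0_iff)
      then show ?thesis
        using homog_mult[OF s homog_single[of m "tdeg m" c]] by (intro deg_homog) auto
    qed
  next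
    case (add p q)
    then show ?case by (simp only: ring_distribs deg_add)
  qed
  then have "?s \<in> Z" by (simp only: poincare_duality simp_thms)
  then show ?thesis by (simp add: eqZ_def)
qed

end

section \<open>The braid fan as a Boolean matroid\<close>

lemma boolean_matroid: "loopless_matroid n n card"
proof
  show "matroid_rank {0..n} card"
    unfolding matroid_rank_def
  proof (intro conjI allI impI)
    fix X Y :: "nat set"
    assume "X \<subseteq> Y \<and> Y \<subseteq> {0..n}"
    then show "card X \<le> card Y" using finite_subset[of Y "{0..n}"] by (intro card_mono) auto
  next
    fix X Y :: "nat set"
    assume "X \<subseteq> {0..n} \<and> Y \<subseteq> {0..n}"
    then have "finite X" "finite Y" using finite_subset[of _ "{0..n}"] by auto
    then show "card (X \<union> Y) + card (X \<inter> Y) \<le> card X + card Y"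
      using card_Un_Int[of X Y] by simp
  qed simp
qed (auto simp: loopless_def)

lemma proper_flats_card: "proper_flats {0..n} card = rays n"
proof -
  have "is_flat {0..n} card F \<longleftrightarrow> F \<subseteq> {0..n}" for F
    using finite_subset[of F "{0..n}"] by (auto simp: is_flat_def)
  then show ?thesis unfolding proper_flats_def rays_def by blast
qed

lemma finite_rays: "finite (rays n)"
  by (rule finite_subset[of _ "Pow {0..n}"]) (auto simp: rays_def)

lemma braid_ideal_gens_subset: "braid_ideal_gens n \<subseteq> polys_in (rays n)"
  unfolding braid_ideal_gens_def
  by (auto intro!: polys_in_mono polys_in_sum polys_in_mult)

lemmas braid_ideal_props = genideal_props[OF braid_ideal_gens_subset, folded braid_ideal_def]

text \<open>A non-face contains two incomparable sets. A linear form with coefficient sum 0 is a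
  combination of the forms attached to \<open>e_i - e_0\<close>, and conversely
  \<open>m = e_i - e_j\<close> gives the matroid relations.\<close>

lemma braid_ideal_eq: "braid_ideal n = chow_matroid_ideal {0..n} card"
proof
  interpret B: loopless_matroid n n card by (rule boolean_matroid)
  note PF = proper_flats_card[of n]
  have "p \<in> chow_matroid_ideal {0..n} card" if p: "p \<in> braid_ideal_gens n" for p
  proof -
    have "p \<in> B.Z"
    proof -
      from p consider T where "p = mono T" "T \<subseteq> rays n" "\<not> is_chain T"
        | m :: "nat \<Rightarrow> int" where
          "p = (\<Sum>S\<in>rays n. Const (real_of_int (\<Sum>i\<in>S. m i)) * Var S)" "(\<Sum>i\<in>{0..n}. m i) = 0"
        unfolding braid_ideal_gens_def by blast
      then show ?thesis
      proof cases
        case 1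
        then obtain F G where FG: "F \<in> T" "G \<in> T" "\<not> F \<subseteq> G" "\<not> G \<subseteq> F"
          unfolding is_chain_def by blast
        have fin: "finite T" using 1(2) finite_rays finite_subset by metis
        have "mono T = mono (T - {G}) * Var G"
          using FG(2) fin by (simp add: mono_def prod.remove mult.commute)
        then show ?thesis
          using B.mono_Var_Z[of "T - {G}" F G] FG fin 1(1) by auto
      next
        case 2
        define a where "a i = (\<Sum>S\<in>{S \<in> rays n. i \<in> S}. Var S)" for i
        have "p = (\<Sum>S\<in>rays n. \<Sum>i\<in>{0..n}. of_bool (i \<in> S) * (Const (real_of_int (m i)) * Var S))"
          unfolding 2(1)
        proof (rule sum.cong[OF refl])
          fix S assume "S \<in> rays n"
          then have S: "S \<subseteq> {0..n}" by (auto simp: rays_def)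
          have C: "Const (\<Sum>i\<in>A. f i) = (\<Sum>i\<in>A. Const (f i))" for A :: "nat set" and f
            by (induction A rule: infinite_finite_induct) (auto simp: Const_add)
          have "Const (real_of_int (\<Sum>i\<in>S. m i)) * Var S = (\<Sum>i\<in>S. Const (real_of_int (m i)) * Var S)"
            by (simp add: C sum_distrib_right)
          also have "\<dots> = (\<Sum>i\<in>{0..n}. of_bool (i \<in> S) * (Const (real_of_int (m i)) * Var S))"
            using S by (intro sum.mono_neutral_cong_left) auto
          finally show "Const (real_of_int (\<Sum>i\<in>S. m i)) * Var S =
            (\<Sum>i\<in>{0..n}. of_bool (i \<in> S) * (Const (real_of_int (m i)) * Var S))" .
        qed
        also have "\<dots> = (\<Sum>i\<in>{0..n}. \<Sum>S\<in>rays n. of_bool (i \<in> S) * (Const (real_of_int (m i)) * Var S))"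
          by (rule sum.swap)
        also have "\<dots> = (\<Sum>i\<in>{0..n}. Const (real_of_int (m i)) * a i)"
          unfolding a_def sum_distrib_left
          by (intro sum.cong[OF refl] sum.mono_neutral_cong_right) (auto simp: finite_rays)
        \<comment> \<open>The correction term with \<open>a 0\<close> is zero because the
          coefficients m sum to 0.\<close>
        also have "\<dots> = (\<Sum>i\<in>{0..n}. Const (real_of_int (m i)) * (a i - a 0)) + (\<Sum>i\<in>{0..n}. Const (real_of_int (m i))) * a 0"
          by (simp only: right_diff_distrib sum_subtractf sum_distrib_right) simp
        also have "(\<Sum>i\<in>A. Const (real_of_int (m i))) = Const (real_of_int (\<Sum>i\<in>A. m i))" for A
          by (induction A rule: infinite_finite_induct) (auto simp: Const_add)
        finally have "p = (\<Sum>i\<in>{0..n}. Const (real_of_int (m i)) * (a i - a 0))"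
          by (simp add: 2(2))
        moreover have "a i - a 0 \<in> B.Z" if "i \<in> {0..n}" for i
          unfolding a_def using B.Z_linear[OF that, of 0] by (simp add: PF)
        ultimately show ?thesis by (auto intro!: B.Z_sum B.Z_mult)
      qed
    qed
    moreover have "p \<in> polys_in (rays n)" using p braid_ideal_gens_subset by blast
    ultimately show ?thesis using B.Z_polys_in[of p] by (simp add: PF)
  qed
  then show "braid_ideal n \<subseteq> chow_matroid_ideal {0..n} card"
    unfolding braid_ideal_def using B.chow_ideal_props
    by (intro genideal_polys_minimal) (auto simp: PF)
  have "p \<in> braid_ideal n" if p: "p \<in> chow_matroid_gens {0..n} card" for p
  proof -
    from p consider F G where "p = Var F * Var G" "F \<in> rays n" "G \<in> rays n" "\<not> F \<subseteq> G" "\<not> G \<subseteq> F"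
      | i j where "p = (\<Sum>F\<in>{F \<in> rays n. i \<in> F}. Var F) - (\<Sum>F\<in>{F \<in> rays n. j \<in> F}. Var F)"
        "i \<in> {0..n}" "j \<in> {0..n}"
      unfolding chow_matroid_gens_def PF by blast
    then have "p \<in> braid_ideal_gens n"
    proof cases
      case 1
      then have "p = mono {F, G}" "{F, G} \<subseteq> rays n" "\<not> is_chain {F, G}"
        by (auto simp: mono_def is_chain_def)
      then show ?thesis unfolding braid_ideal_gens_def by blast
    next
      case 2
      define m :: "nat \<Rightarrow> int" where "m k = of_bool (k = i) - of_bool (k = j)" for k
      have sum_m: "(\<Sum>k\<in>S. m k) = of_bool (i \<in> S) - of_bool (j \<in> S)" if "finite S" for S
        using that by (simp add: m_def sum_subtractf of_bool_def)
      have "(\<Sum>S\<in>rays n. Const (real_of_int (\<Sum>k\<in>S. m k)) * Var S) =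
          (\<Sum>S\<in>rays n. of_bool (i \<in> S) * Var S - of_bool (j \<in> S) * Var S)"
      proof (rule sum.cong[OF refl])
        fix S assume "S \<in> rays n"
        then have "finite S" by (intro finite_subset[of S "{0..n}"]) (auto simp: rays_def)
        then show "Const (real_of_int (\<Sum>k\<in>S. m k)) * Var S = of_bool (i \<in> S) * Var S - of_bool (j \<in> S) * Var S"
          using Const_uminus[of 1] by (simp add: sum_m of_bool_def)
      qed
      also have "\<dots> = (\<Sum>S\<in>rays n. of_bool (i \<in> S) * Var S) - (\<Sum>S\<in>rays n. of_bool (j \<in> S) * Var S)"
        by (rule sum_subtractf)
      also have "\<dots> = p"
      proof -
        have "(\<Sum>S\<in>rays n. of_bool (k \<in> S) * Var S) = (\<Sum>F\<in>{F \<in> rays n. k \<in> F}. Var F)" for k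
          using finite_rays by (intro sum.mono_neutral_cong_right) auto
        then show ?thesis unfolding 2(1) by (simp only:)
      qed
      finally have "p = (\<Sum>S\<in>rays n. Const (real_of_int (\<Sum>k\<in>S. m k)) * Var S)" by (rule sym)
      moreover have "\<forall>k. k \<notin> {0..n} \<longrightarrow> m k = 0" using 2(2,3) by (auto simp: m_def)
      moreover have "(\<Sum>k\<in>{0..n}. m k) = 0" using 2(2,3) sum_m[of "{0..n}"] by simp
      ultimately show ?thesis unfolding braid_ideal_gens_def by blast
    qed
    then show ?thesis using braid_ideal_props(1) by blast
  qed
  then show "chow_matroid_ideal {0..n} card \<subseteq> braid_ideal n"
    unfolding chow_matroid_ideal_def PF using braid_ideal_props
    by (intro genideal_polys_minimal) auto
qed

section \<open>Quotients, annihilators and evaluation of Minkowski weights\<close>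

lemma (in ideal) rcos_eq_zero_iff: "a \<in> carrier R \<Longrightarrow> I +> a = \<zero>\<^bsub>R Quot I\<^esub> \<longleftrightarrow> a \<in> I"
  using rcos_const_imp_mem a_rcos_const by (auto simp: FactRing_def)

lemma carrier_Quot: "carrier (R Quot I) = (+>\<^bsub>R\<^esub>) I ` carrier R"
  by (auto simp: FactRing_def A_RCOSETS_def')

lemma annihilator_ideal:
  assumes "cring R" "D \<in> carrier R"
  shows "ideal (annihilator R D) R"
proof -
  interpret cring R by fact
  show ?thesis
  proof (rule idealI)
    show "ring R" by (rule local.ring_axioms)
    show "subgroup (annihilator R D) (add_monoid R)"
    proof (rule add.subgroupI)
      show "annihilator R D \<noteq> {}"
        using assms(2) zero_closed l_null unfolding annihilator_def by blast
    qed (use assms(2) in \<open>auto simp: annihilator_def l_minus l_distr\<close>)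
    show ann: "x \<otimes>\<^bsub>R\<^esub> a \<in> annihilator R D" if "a \<in> annihilator R D" "x \<in> carrier R" for a x
      using that assms(2) by (simp add: annihilator_def m_assoc)
    show "a \<otimes>\<^bsub>R\<^esub> x \<in> annihilator R D" if "a \<in> annihilator R D" "x \<in> carrier R" for a x
      using ann[OF that] that by (simp add: annihilator_def m_comm)
  qed
qed

text \<open>The definite description is resolved by the Boolean degree. A value exists because p is
  a multiple of one maximal chain monomial; it is unique because every maximal chain monomial has
  degree 1.\<close>

lemma mw_eval_top:
  assumes "p \<in> polys_in (rays n)" "p \<in> homog n"
  shows "mw_eval n n (\<lambda>_. 1) (braid_ideal n +>\<^bsub>poly_ring (rays n)\<^esub> p) = loopless_matroid.deg n n card p"
proof -
  interpret B: loopless_matroid n n card by (rule boolean_matroid)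
  note PF = proper_flats_card[of n]
  let ?R = "poly_ring (rays n)"
  interpret R: cring ?R by (rule cring_poly_ring)
  have idl: "ideal (braid_ideal n) ?R"
    unfolding braid_ideal_def by (rule ideal_genideal[OF braid_ideal_gens_subset])
  have coset_eq: "braid_ideal n +>\<^bsub>?R\<^esub> a = braid_ideal n +>\<^bsub>?R\<^esub> b \<longleftrightarrow> B.eqZ a b"
    if "a \<in> polys_in (rays n)" "b \<in> polys_in (rays n)" for a b
  proof -
    have "a \<ominus>\<^bsub>?R\<^esub> b = a - b"
      using that R.minus_eq[of a b] R.minus_equality[of "- b" b]
      by (simp add: poly_ring_def polys_in_uminus)
    then show ?thesis
      using R.quotient_eq_iff_same_a_r_cos[OF idl, of a b] that polys_in_diff[OF that] B.Z_polys_in[of "a - b"]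
      by (simp add: poly_ring_def B.eqZ_def braid_ideal_eq PF)
  qed
  let ?S = "{\<tau>. braid_cone n n \<tau>}"
  have finS: "finite ?S"
    by (rule finite_subset[of _ "Pow (rays n)"]) (auto simp: braid_cone_def finite_rays)
  have in_polys: "(\<Sum>\<tau>\<in>?S. Const (a \<tau>) * mono \<tau>) \<in> polys_in (rays n)" for a
    by (intro polys_in_sum polys_in_mult polys_in_mono) (auto simp: braid_cone_def)
  \<comment> \<open>The initial segments of E form a concrete n-cone; for \<open>n = 0\<close> it is
    the empty chain.\<close>
  define T where "T = (\<lambda>i. {0..i}) ` {..<n}"
  have inj: "inj_on (\<lambda>i. {0..i}) {..<n}" by (rule inj_onI) auto
  have T: "braid_cone n n T"
    unfolding braid_cone_def
  proof (intro conjI)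
    show "T \<subseteq> rays n" by (auto simp: T_def rays_def)
    show "is_chain T" by (auto simp: T_def is_chain_def)
    show "card T = n" unfolding T_def by (simp add: card_image[OF inj])
  qed
  show ?thesis
    unfolding mw_eval_def
  proof (rule the_equality)
    define a where "a \<tau> = (if \<tau> = T then B.deg p else 0)" for \<tau>
    have "(\<Sum>\<tau>\<in>?S. Const (a \<tau>) * mono \<tau>) = (\<Sum>\<tau>\<in>{T}. Const (B.deg p) * mono \<tau>)"
      using finS T by (intro sum.mono_neutral_cong_right) (auto simp: a_def)
    moreover have "B.eqZ p (Const (B.deg p) * mono T)"
      using T assms(2) by (intro B.top_degree_multiple) (auto simp: braid_cone_def PF)
    ultimately have "B.eqZ p (\<Sum>\<tau>\<in>?S. Const (a \<tau>) * mono \<tau>)" by simp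
    then have "braid_ideal n +>\<^bsub>?R\<^esub> p = braid_ideal n +>\<^bsub>?R\<^esub> (\<Sum>\<tau>\<in>?S. Const (a \<tau>) * mono \<tau>)"
      by (rule coset_eq[OF assms(1) in_polys, THEN iffD2])
    moreover have "B.deg p = (\<Sum>\<tau>\<in>?S. a \<tau> * 1)"
      using finS T by (simp add: a_def)
    ultimately show "\<exists>a. braid_ideal n +>\<^bsub>?R\<^esub> p = braid_ideal n +>\<^bsub>?R\<^esub> (\<Sum>\<tau>\<in>?S. Const (a \<tau>) * mono \<tau>) \<and>
        B.deg p = (\<Sum>\<tau>\<in>?S. a \<tau> * 1)" by blast
  next
    fix c
    assume "\<exists>a. braid_ideal n +>\<^bsub>?R\<^esub> p = braid_ideal n +>\<^bsub>?R\<^esub> (\<Sum>\<tau>\<in>?S. Const (a \<tau>) * mono \<tau>) \<and>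
        c = (\<Sum>\<tau>\<in>?S. a \<tau> * 1)"
    then obtain a where "B.eqZ p (\<Sum>\<tau>\<in>?S. Const (a \<tau>) * mono \<tau>)" and c: "c = (\<Sum>\<tau>\<in>?S. a \<tau> * 1)"
      using coset_eq[OF assms(1) in_polys] by blast
    then have "B.deg p = (\<Sum>\<tau>\<in>?S. a \<tau> * B.deg (mono \<tau>))"
      using B.deg_eqZ by (simp add: B.deg_sum B.deg_Const)
    also have "\<dots> = c"
      unfolding c
    proof (rule sum.cong[OF refl])
      fix \<tau> assume "\<tau> \<in> ?S"
      then have "B.deg (mono \<tau>) = 1" by (intro B.deg_flag) (simp_all add: braid_cone_def PF)
      then show "a \<tau> * B.deg (mono \<tau>) = a \<tau> * 1" by simp
    qed
    finally show "c = B.deg p" by simp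
  qed
qed

section \<open>Passage from the braid fan to the matroid\<close>

lemma (in loopless_matroid) PF_subset_rays: "PF \<subseteq> rays n"
proof
  fix F assume F: "F \<in> PF"
  then have "F \<noteq> {}" "F \<noteq> E" by (simp_all add: PF_iff)
  then show "F \<in> rays n" using PF_subset_E[OF F] unfolding rays_def by blast
qed

text \<open>Variables of non-flats lie in Z, so modulo Z each linear form of the braid fan loses
  exactly these terms and becomes the one of the matroid. This yields the map from the braid ring to
  A(M).\<close>

lemma (in loopless_matroid) boolean_Z_subset:
  assumes "p \<in> loopless_matroid.Z n card"
  shows "p \<in> Z"
proof -
  interpret B: loopless_matroid n n card by (rule boolean_matroid)
  note PFB = proper_flats_card[of n]
  note PF_rays = PF_subset_rays
  have split: "(\<Sum>F\<in>{F \<in> rays n. i \<in> F}. Var F) \<approx> (\<Sum>F\<in>{F \<in> PF. i \<in> F}. Var F)" for i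
  proof -
    have "(\<Sum>F\<in>{F \<in> rays n. i \<in> F}. Var F) =
        (\<Sum>F\<in>{F \<in> PF. i \<in> F}. Var F) + (\<Sum>F\<in>{F \<in> rays n - PF. i \<in> F}. Var F)"
      using PF_rays by (subst sum.union_disjoint[symmetric]) (auto simp: finite_rays intro!: sum.cong)
    moreover have "(\<Sum>F\<in>{F \<in> rays n - PF. i \<in> F}. Var F) \<in> Z"
      by (intro Z_sum Z_Var) auto
    ultimately show ?thesis by (simp add: eqZ_def)
  qed
  have "chow_matroid_ideal {0..n} card \<subseteq> {p \<in> polys_in (rays n). p \<in> Z}"
    unfolding chow_matroid_ideal_def PFB
  proof (rule genideal_polys_minimal)
    show "chow_matroid_gens {0..n} card \<subseteq> {p \<in> polys_in (rays n). p \<in> Z}"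
    proof
      fix p assume p: "p \<in> chow_matroid_gens {0..n} card"
      then consider F G where "p = Var F * Var G" "\<not> F \<subseteq> G" "\<not> G \<subseteq> F"
        | i j where "p = (\<Sum>F\<in>{F \<in> rays n. i \<in> F}. Var F) - (\<Sum>F\<in>{F \<in> rays n. j \<in> F}. Var F)"
          "i \<in> E" "j \<in> E"
        unfolding chow_matroid_gens_def PFB by blast
      then have "p \<in> Z"
      proof cases
        case 1
        then show ?thesis using Z_incomparable by simp
      next
        case 2
        have "(\<Sum>F\<in>{F \<in> rays n. i \<in> F}. Var F) \<approx> (\<Sum>F\<in>{F \<in> PF. i \<in> F}. Var F)" by (rule split)
        also have "\<dots> \<approx> (\<Sum>F\<in>{F \<in> PF. j \<in> F}. Var F)"
          unfolding eqZ_def using 2(2,3) by (rule Z_linear)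
        also have "\<dots> \<approx> (\<Sum>F\<in>{F \<in> rays n. j \<in> F}. Var F)" by (rule eqZ_sym[OF split])
        finally show ?thesis unfolding 2(1) eqZ_def .
      qed
      then show "p \<in> {p \<in> polys_in (rays n). p \<in> Z}"
        using p subsetD[OF B.chow_matroid_gens_subset p] by (simp add: PFB)
    qed
  qed (simp_all add: Z_add Z_mult polys_in_add polys_in_mult subset_eq)
  then have "B.retract p \<in> Z" using assms by (auto simp: B.Z_def)
  moreover have "retract (B.retract p) = retract p"
    unfolding retract_def B.retract_def subst_subst
    using PF_rays by (intro arg_cong[where f = "\<lambda>f. subst f p"] ext) (auto simp: PFB)
  ultimately show ?thesis by (simp add: Z_def)
qed

theorem theorem4p5:
  fixes n d :: nat and r :: "nat set \<Rightarrow> nat" and D :: "poly set"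
  assumes "matroid_rank {0..n} r"
    and "loopless {0..n} r"
    and "r {0..n} = d + 1"
    and "D \<in> graded_piece (rays n) (braid_ideal n) (n - d)"
    and "\<forall>\<sigma>. braid_cone n d \<sigma> \<longrightarrow> delta_braid n D \<sigma> = bergman_class {0..n} r \<sigma>"
  shows "\<exists>\<phi>. \<phi> \<in> ring_iso (chow_matroid {0..n} r)
                 (chow_braid n Quot annihilator (chow_braid n) D)
          \<and> (\<forall>k. \<phi> ` graded_piece (proper_flats {0..n} r) (chow_matroid_ideal {0..n} r) k
                 = {annihilator (chow_braid n) D +>\<^bsub>chow_braid n\<^esub> \<xi> | \<xi>.
                      \<xi> \<in> graded_piece (rays n) (braid_ideal n) k})"
proof -
  interpret M: loopless_matroid n d r using assms(1-3) by unfold_locales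
  interpret B: loopless_matroid n n card by (rule boolean_matroid)
  note PFB = proper_flats_card[of n]
  let ?R = "poly_ring (rays n)" and ?I = "braid_ideal n" and ?A = "chow_braid n"
  let ?ann = "annihilator ?A D"
  note PF_rays = M.PF_subset_rays
  have carrier: "carrier ?R = polys_in (rays n)" by (simp add: poly_ring_def)
  have idl: "ideal ?I ?R"
    unfolding braid_ideal_def by (rule ideal_genideal[OF braid_ideal_gens_subset])
  have A_cring: "cring ?A"
    unfolding chow_braid_def by (rule ideal.quotient_is_cring[OF idl cring_poly_ring])
  have projI: "(+>\<^bsub>?R\<^esub>) ?I \<in> ring_hom ?R ?A"
    unfolding chow_braid_def by (rule ideal.rcos_ring_hom[OF idl])
  obtain pD where pD: "D = ?I +>\<^bsub>?R\<^esub> pD" "pD \<in> polys_in (rays n)" "pD \<in> homog (n - d)"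
    using assms(4) unfolding graded_piece_def by auto
  have D: "D \<in> carrier ?A"
    using ring_hom_closed[OF projI, of pD] pD by (simp add: carrier)
  have coset_mult: "(?I +>\<^bsub>?R\<^esub> p) \<otimes>\<^bsub>?A\<^esub> (?I +>\<^bsub>?R\<^esub> q) = ?I +>\<^bsub>?R\<^esub> (p * q)"
    if "p \<in> polys_in (rays n)" "q \<in> polys_in (rays n)" for p q
    using ring_hom_mult[OF projI, of p q] that by (simp add: poly_ring_def)
  \<comment> \<open>The subtraction in \<open>n - d\<close> is truncated; \<open>d \<le> n\<close>
    ensures that \<open>n - d + card C\<close> equals n exactly when
    \<open>card C = d\<close>.\<close>
  have "r {0..n} \<le> card {0..n}" using assms(1) unfolding matroid_rank_def by blast
  then have dn: "d \<le> n" using assms(3) by simp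

  have deg_eq: "B.deg (pD * u) = M.deg u" for u
  proof -
    have "B.deg (pD * u) - M.deg u = 0"
    \<comment> \<open>Both degrees are functionals on the braid ring, the second by
      \<open>boolean_Z_subset\<close>, so it suffices to compare them on chains. Chains of length
      other than d give 0 twice by degree; for the others the value of \<open>delta_braid\<close> is
      the Boolean degree.\<close>
    proof (rule B.functional_zero[where L = "\<lambda>u. B.deg (pD * u) - M.deg u"])
      fix p q c
      show "B.deg (pD * (p + q)) - M.deg (p + q) = B.deg (pD * p) - M.deg p + (B.deg (pD * q) - M.deg q)"
        by (simp add: ring_distribs B.deg_add M.deg_add)
      have "pD * (Const c * p) = Const c * (pD * p)" by (simp add: mult_ac)
      then show "B.deg (pD * (Const c * p)) - M.deg (Const c * p) = c * (B.deg (pD * p) - M.deg p)"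
        by (simp only: B.deg_Const M.deg_Const right_diff_distrib)
    next
      fix p assume "p \<in> B.Z"
      then show "B.deg (pD * p) - M.deg p = 0"
        using B.deg_Z[OF B.Z_mult] M.deg_Z[OF M.boolean_Z_subset] by simp
    next
      fix C assume C: "C \<subseteq> proper_flats {0..n} card" "is_chain C"
      have CR: "C \<subseteq> rays n" using C PFB by simp
      have fin: "finite C" using CR finite_rays finite_subset by metis
      have hom: "pD * mono C \<in> homog (n - d + card C)"
        using pD(3) homog_mono[OF fin] by (rule homog_mult)
      have polys: "pD * mono C \<in> polys_in (rays n)"
        using pD(2) CR by (intro polys_in_mult polys_in_mono)
      show "B.deg (pD * mono C) - M.deg (mono C) = 0"
      proof (cases "card C = d")
        case False
        then have "M.deg (mono C) = 0" by (intro M.deg_homog[OF homog_mono[OF fin]])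
        moreover have "B.deg (pD * mono C) = 0" using False dn by (intro B.deg_homog[OF hom]) auto
        ultimately show ?thesis by simp
      next
        case True
        then have "braid_cone n d C" using CR C by (simp add: braid_cone_def)
        then have "delta_braid n D C = bergman_class {0..n} r C" using assms(5) by blast
        moreover have "delta_braid n D C = B.deg (pD * mono C)"
        proof -
          have "delta_braid n D C = mw_eval n n (\<lambda>_. 1) (?I +>\<^bsub>?R\<^esub> (pD * mono C))"
            unfolding delta_braid_def cap_def pD(1)
            using coset_mult[OF pD(2) polys_in_mono[OF CR]] by simp
          then show ?thesis
            using mw_eval_top[OF polys] hom True dn by simp
        qed
        moreover have "bergman_class {0..n} r C = M.deg (mono C)"
        proof (cases "\<forall>F\<in>C. is_flat {0..n} r F")
          case flats: True
          then have "C \<subseteq> proper_flats {0..n} r"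
            using CR by (auto simp: proper_flats_def rays_def)
          then show ?thesis
            using M.deg_flag[OF _ C(2) True] flats by (simp add: bergman_class_def)
        next
          case False
          then obtain F where F: "F \<in> C" "\<not> is_flat {0..n} r F" by blast
          have "mono C = Var F * mono (C - {F})" using F(1) fin by (simp add: mono_def prod.remove)
          moreover have "Var F \<in> M.Z" using F(2) by (intro M.Z_Var) (simp add: M.PF_iff)
          ultimately have "mono C \<in> M.Z" using M.Z_mult_right by simp
          then show ?thesis using M.deg_Z False by (simp add: bergman_class_def)
        qed
        ultimately show ?thesis by simp
      qed
    qed
    then show ?thesis by simp
  qed

  have ann_iff: "?I +>\<^bsub>?R\<^esub> q \<in> ?ann \<longleftrightarrow> q \<in> M.Z" if q: "q \<in> polys_in (rays n)" for q
  proof -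
    have qp: "q * pD \<in> polys_in (rays n)" using q pD(2) by (rule polys_in_mult)
    have "?I +>\<^bsub>?R\<^esub> q \<in> carrier ?A" using ring_hom_closed[OF projI, of q] q carrier by simp
    then have "?I +>\<^bsub>?R\<^esub> q \<in> ?ann \<longleftrightarrow> ?I +>\<^bsub>?R\<^esub> (q * pD) = \<zero>\<^bsub>?A\<^esub>"
      using coset_mult[OF q pD(2)] by (simp add: annihilator_def pD(1))
    also have "\<dots> \<longleftrightarrow> q * pD \<in> ?I"
      unfolding chow_braid_def using ideal.rcos_eq_zero_iff[OF idl, of "q * pD"] qp carrier by simp
    also have "\<dots> \<longleftrightarrow> q * pD \<in> B.Z"
      using B.Z_polys_in[of "q * pD"] qp by (simp add: braid_ideal_eq PFB)
    also have "\<dots> \<longleftrightarrow> (\<forall>s. M.deg (q * s) = 0)"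
      unfolding B.poincare_duality deg_eq[symmetric] by (simp add: mult_ac)
    also have "\<dots> \<longleftrightarrow> q \<in> M.Z" by (rule M.poincare_duality[symmetric])
    finally show ?thesis .
  qed

  have ann_ideal: "ideal ?ann ?A" by (rule annihilator_ideal[OF A_cring D])
  let ?T = "?A Quot ?ann"
  have T_ring: "ring ?T" by (rule ideal.quotient_is_ring[OF ann_ideal])
  \<comment> \<open>Both quotients are taken at once on the level of polynomials. Restricted to
    polynomials in the proper flats, H has the Chow ideal as kernel and is still onto, so it induces
    the isomorphism from A(M).\<close>
  define H where "H q = ?ann +>\<^bsub>?A\<^esub> (?I +>\<^bsub>?R\<^esub> q)" for q
  have H_hom: "H \<in> ring_hom ?R ?T"
    using ring_hom_trans[OF projI ideal.rcos_ring_hom[OF ann_ideal]] by (simp add: H_def[abs_def] comp_def)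
  have H_zero: "H q = \<zero>\<^bsub>?T\<^esub> \<longleftrightarrow> q \<in> M.Z" if q: "q \<in> polys_in (rays n)" for q
    unfolding H_def using ideal.rcos_eq_zero_iff[OF ann_ideal] ann_iff[OF q]
      ring_hom_closed[OF projI, of q] q carrier by simp
  have H_surj: "carrier ?T = H ` polys_in (rays n)"
    unfolding H_def using carrier
    by (simp add: carrier_Quot chow_braid_def image_image)

  let ?S = "poly_ring (proper_flats {0..n} r)"
  have S_carrier: "carrier ?S = polys_in (proper_flats {0..n} r)" by (simp add: poly_ring_def)
  have sub: "polys_in (proper_flats {0..n} r) \<subseteq> polys_in (rays n)" by (rule polys_in_subset[OF PF_rays])
  have "H \<in> ring_hom ?S ?T"
  proof (rule ring_hom_memI)
    have cS: "p \<in> carrier ?R" if "p \<in> carrier ?S" for p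
      using that sub S_carrier carrier by auto
    show "H p \<in> carrier ?T" if "p \<in> carrier ?S" for p
      by (rule ring_hom_closed[OF H_hom cS[OF that]])
    show "H (p \<otimes>\<^bsub>?S\<^esub> q) = H p \<otimes>\<^bsub>?T\<^esub> H q" "H (p \<oplus>\<^bsub>?S\<^esub> q) = H p \<oplus>\<^bsub>?T\<^esub> H q"
      if "p \<in> carrier ?S" "q \<in> carrier ?S" for p q
      using ring_hom_mult[OF H_hom that[THEN cS]] ring_hom_add[OF H_hom that[THEN cS]]
      by (simp_all add: poly_ring_def)
    show "H \<one>\<^bsub>?S\<^esub> = \<one>\<^bsub>?T\<^esub>" using ring_hom_one[OF H_hom] by (simp add: poly_ring_def)
  qed
  then interpret H: ring_hom_ring ?S ?T H
    using cring.axioms(1)[OF cring_poly_ring] T_ring by (intro ring_hom_ringI2)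
  have kernel: "a_kernel ?S ?T H = chow_matroid_ideal {0..n} r"
    unfolding a_kernel_def' S_carrier
    using H_zero sub M.Z_polys_in M.chow_ideal_props(2) by auto
  \<comment> \<open>Retraction changes q by an element of \<open>M.Z\<close>, on which H vanishes.
    Every class therefore has a representative in the proper flats.\<close>
  have H_retract: "H q = H (M.retract q)" if q: "q \<in> polys_in (rays n)" for q
  proof -
    have ret: "M.retract q \<in> polys_in (proper_flats {0..n} r)" by (rule M.retract_in)
    then have ret': "M.retract q \<in> polys_in (rays n)" using sub by blast
    have "M.retract (q - M.retract q) = 0"
      using M.retract_id[OF ret] by (simp add: M.retract_def subst_diff)
    then have "q - M.retract q \<in> M.Z" using M.chow_ideal_props(3) by (simp add: M.Z_def)
    then have "H (q - M.retract q) = \<zero>\<^bsub>?T\<^esub>" using H_zero[OF polys_in_diff[OF q ret']] by simp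
    moreover have "H q = H (q - M.retract q) \<oplus>\<^bsub>?T\<^esub> H (M.retract q)"
      using ring_hom_add[OF H_hom, of "q - M.retract q" "M.retract q"] polys_in_diff[OF q ret'] ret'
      by (simp add: poly_ring_def)
    moreover have "H (M.retract q) \<in> carrier ?T"
      using ring_hom_closed[OF H_hom] ret' carrier by simp
    ultimately show ?thesis by (simp add: ring.ring_simprules(8)[OF T_ring])
  qed
  have surj: "H ` carrier ?S = carrier ?T"
  proof
    show "carrier ?T \<subseteq> H ` carrier ?S"
      unfolding H_surj S_carrier using H_retract M.retract_in by blast
  qed (use H.hom_closed in blast)
  have hom_retract: "M.retract q \<in> homog k" if "q \<in> homog k" for q k
    unfolding M.retract_def using that by (intro homog_subst) auto
  \<comment> \<open>H is constant on each coset of its kernel, so the image of a coset is a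
    singleton.\<close>
  define \<phi> where "\<phi> C = the_elem (H ` C)" for C
  have \<phi>_coset: "\<phi> (chow_matroid_ideal {0..n} r +>\<^bsub>?S\<^esub> p) = H p"
    if "p \<in> polys_in (proper_flats {0..n} r)" for p
    using H.the_elem_simp[of p] that by (simp add: \<phi>_def kernel S_carrier)
  have "\<phi> \<in> ring_iso (chow_matroid {0..n} r) ?T"
    using H.FactRing_iso_set[OF surj] by (simp add: \<phi>_def[abs_def] kernel chow_matroid_def)
  moreover have "\<phi> ` graded_piece (proper_flats {0..n} r) (chow_matroid_ideal {0..n} r) k
      = {?ann +>\<^bsub>?A\<^esub> \<xi> | \<xi>. \<xi> \<in> graded_piece (rays n) ?I k}" (is "?L = ?Q") for k
  proof -
    have "?L = H ` (polys_in (proper_flats {0..n} r) \<inter> homog k)"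
      unfolding graded_piece_def using \<phi>_coset by (force simp: image_def)
    \<comment> \<open>Retraction keeps polynomials homogeneous of degree k, so the representatives
      in the proper flats can be chosen in the same degree.\<close>
    also have "\<dots> = H ` (polys_in (rays n) \<inter> homog k)"
    proof
      show "H ` (polys_in (rays n) \<inter> homog k) \<subseteq> H ` (polys_in (proper_flats {0..n} r) \<inter> homog k)"
        using H_retract M.retract_in hom_retract by blast
    qed (use sub in blast)
    also have "\<dots> = ?Q" unfolding graded_piece_def H_def by blast
    finally show ?thesis .
  qed
  ultimately show ?thesis by blast
qed

end
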